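(* The elementary cellular automata with Wolfram codes $6$ and $7$ are coalescing for the fully asynchronous dynamic when $n$ is odd, where $n$ is the number of cells.
   Context: An elementary cellular automaton (ECA) has cell space $\mathcal{U}=\mathbb{Z}/n\mathbb{Z}$ (size $n$, periodic boundary), states $\{0,1\}$, and a rule $\delta:\{0,1\}^3\to\{0,1\}$ applied to (left neighbor, cell itself, right neighbor). Its Wolfram code is $2^7\delta(1,1,1)+2^6\delta(1,1,0)+2^5\delta(1,0,1)+2^4\delta(1,0,0)+2^3\delta(0,1,1)+2^2\delta(0,1,0)+2\,\delta(0,0,1)+\delta(0,0,0)$. Thus for code $6$, $\delta$ equals $1$ exactly on $(0,1,0)$ and $(0,0,1)$; for code $7$, exactly on $(0,1,0)$, $(0,0,1)$ and $(0,0,0)$. Fully asynchronous dynamic: at each time step $t$ one cell $z_t\in\mathcal{U}$ is chosen uniformly at random, independently of the past, and only this cell is updated: $c_{t+1}(z_t)=\delta(c_t(z_t-1),c_t(z_t),c_t(z_t+1))$ and $c_{t+1}(z)=c_t(z)$ for $z\ne z_t$. Coalescing: the automaton is coalescing if, for any two initial configurations, applying the same sequence of updates (the same sequence of cells $(z_t)$) to both leads both configurations to become identical within polynomial expected time with respect to $n$.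
   Formalization: For code 6 both initial configurations are assumed not all-zero (all-zero is a fixed point that no nonzero configuration reaches when n ≥ 2); for code 7, n = 1 is excluded (the single cell flips at every update, so 0 and 1 never coalesce). *)

theory Defs
  imports "HOL-Probability.Probability"
begin

text \<open>
  A configuration on the ring of \<open>n\<close> cells is a function on \<open>nat\<close> of which only the
  values on \<open>{..<n}\<close> (representatives of the integers modulo \<open>n\<close>) are relevant.
\<close>

type_synonym configuration = "nat \<Rightarrow> bool"
type_synonym local_rule = "bool \<Rightarrow> bool \<Rightarrow> bool \<Rightarrow> bool"

definition wolfram_code :: "local_rule \<Rightarrow> nat" where
  "wolfram_code \<delta> =
     2 ^ 7 * of_bool (\<delta> True True True) + 2 ^ 6 * of_bool (\<delta> True True False)
   + 2 ^ 5 * of_bool (\<delta> True False True) + 2 ^ 4 * of_bool (\<delta> True False False)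
   + 2 ^ 3 * of_bool (\<delta> False True True) + 2 ^ 2 * of_bool (\<delta> False True False)
   + 2 * of_bool (\<delta> False False True) + of_bool (\<delta> False False False)"

text \<open>\<open>z + n - 1\<close> rather than \<open>z - 1\<close>: subtraction on \<open>nat\<close> truncates at \<open>0\<close>.\<close>

definition update_cell :: "local_rule \<Rightarrow> nat \<Rightarrow> nat \<Rightarrow> configuration \<Rightarrow> configuration" where
  "update_cell \<delta> n z c = c(z := \<delta> (c ((z + n - 1) mod n)) (c z) (c ((z + 1) mod n)))"

primrec config_at ::
  "local_rule \<Rightarrow> nat \<Rightarrow> configuration \<Rightarrow> nat stream \<Rightarrow> nat \<Rightarrow> configuration" where
  "config_at \<delta> n c \<omega> 0 = c"
| "config_at \<delta> n c \<omega> (Suc t) = update_cell \<delta> n (\<omega> !! t) (config_at \<delta> n c \<omega> t)"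

definition same_config :: "nat \<Rightarrow> configuration \<Rightarrow> configuration \<Rightarrow> bool" where
  "same_config n c c' \<longleftrightarrow> (\<forall>z<n. c z = c' z)"

text \<open>
  The first time at which the two configurations, driven by the same updates, are identical;
  it is \<open>\<infinity>\<close> (the infimum of the empty set) if this never happens.
\<close>

definition coalescence_time ::
  "local_rule \<Rightarrow> nat \<Rightarrow> configuration \<Rightarrow> configuration \<Rightarrow> nat stream \<Rightarrow> ennreal" where
  "coalescence_time \<delta> n c c' \<omega> =
     (INF t \<in> {t. same_config n (config_at \<delta> n c \<omega> t) (config_at \<delta> n c' \<omega> t)}. of_nat t)"

text \<open>Sequences of independent cells, each uniform on \<open>{..<n}\<close>.\<close>

definition update_sequences :: "nat \<Rightarrow> nat stream measure" where
  "update_sequences n = stream_space (measure_pmf (pmf_of_set {..<n}))"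

definition expected_coalescence_time ::
  "local_rule \<Rightarrow> nat \<Rightarrow> configuration \<Rightarrow> configuration \<Rightarrow> ennreal" where
  "expected_coalescence_time \<delta> n c c' =
     (\<integral>\<^sup>+ \<omega>. coalescence_time \<delta> n c c' \<omega> \<partial>update_sequences n)"

text \<open>
  Coalescence for the sizes in \<open>N\<close>, from initial configurations in \<open>A n\<close>. The bound is uniform
  in \<open>n\<close> and in both initial configurations. With \<open>A = (\<lambda>_. UNIV)\<close> all pairs of initial
  configurations are considered.
\<close>

definition coalescing ::
  "local_rule \<Rightarrow> nat set \<Rightarrow> (nat \<Rightarrow> configuration set) \<Rightarrow> bool" where
  "coalescing \<delta> N A \<longleftrightarrow>
     (\<exists>(C::real) (k::nat). \<forall>n\<in>N. \<forall>c\<in>A n. \<forall>c'\<in>A n.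
        expected_coalescence_time \<delta> n c c' \<le> ennreal (C * real n ^ k))"

definition nonzero_configs :: "nat \<Rightarrow> configuration set" where
  "nonzero_configs n = {c. \<exists>z<n. c z}"

text \<open>
  Two degenerate cases never coalesce, so a correct statement has to leave them out.
  For code 6 the all-zero configuration is a fixed point, while an isolated 1 is never erased, so
  that a nonzero configuration never reaches it (unless \<open>n = 1\<close>). For code 7 and \<open>n = 1\<close>, the
  cell is its own neighbour on both sides and each update flips it.
\<close>

lemma expected_coalescence_time_infinite:
  assumes "\<And>\<omega> t. \<not> same_config n (config_at \<delta> n c \<omega> t) (config_at \<delta> n c' \<omega> t)"
  shows "expected_coalescence_time \<delta> n c c' = \<infinity>"
proof -
  interpret prob_space "update_sequences n"
    unfolding update_sequences_def by (rule prob_space.prob_space_stream_space[OF prob_space_measure_pmf])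
  have "coalescence_time \<delta> n c c' = (\<lambda>_. \<infinity>)"
    using assms by (simp add: coalescence_time_def fun_eq_iff)
  then show ?thesis
    by (simp add: expected_coalescence_time_def emeasure_space_1)
qed

lemma code6_iff:
  assumes "wolfram_code \<delta> = 6"
  shows "\<delta> l s r \<longleftrightarrow> \<not> l \<and> s \<noteq> r"
  using assms unfolding wolfram_code_def
  by (cases l; cases s; cases r) (auto simp: of_bool_def split: if_splits)

lemma code7_iff:
  assumes "wolfram_code \<delta> = 7"
  shows "\<delta> l s r \<longleftrightarrow> \<not> l \<and> \<not> (s \<and> r)"
  using assms unfolding wolfram_code_def
  by (cases l; cases s; cases r) (auto simp: of_bool_def split: if_splits)

lemma code6_zero_never_coalesces:
  assumes code: "wolfram_code \<delta> = 6" and n: "n \<ge> 2" and c: "c \<in> nonzero_configs n"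
  shows "expected_coalescence_time \<delta> n (\<lambda>_. False) c = \<infinity>"
proof (rule expected_coalescence_time_infinite)
  fix \<omega> t
  have zero: "config_at \<delta> n (\<lambda>_. False) \<omega> t = (\<lambda>_. False)"
    by (induction t) (auto simp: update_cell_def code6_iff[OF code])
  have "config_at \<delta> n c \<omega> t \<in> nonzero_configs n"
  proof (induction t)
    case 0
    then show ?case using c by simp
  next
    case (Suc t)
    define d z where "d = config_at \<delta> n c \<omega> t" and "z = \<omega> !! t"
    from Suc obtain y where y: "y < n" "d y"
      by (auto simp: nonzero_configs_def d_def)
    let ?l = "(z + n - 1) mod n" and ?r = "(z + 1) mod n"
    have lr: "?l < n" "?r < n" using n by auto
    have ne: "?l \<noteq> z" "?r \<noteq> z"
    proof -
      show "?l \<noteq> z"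
      proof
        assume eq: "?l = z"
        then have "z < n" using lr by simp
        show False
        proof (cases z)
          case 0
          have "?l = n - 1" unfolding 0 using n by simp
          with eq 0 n show False by linarith
        next
          case (Suc k)
          then have "z + n - 1 = k + n" by simp
          moreover have "(k + n) mod n = k" using Suc \<open>z < n\<close> by simp
          ultimately have "k = z" using eq by metis
          then show False using Suc by simp
        qed
      qed
      show "?r \<noteq> z"
      proof
        assume eq: "?r = z"
        then have "z < n" using lr by simp
        with eq n show False by (cases "z + 1 = n") auto
      qed
    qed
    have upd: "update_cell \<delta> n z d = d(z := \<not> d ?l \<and> d z \<noteq> d ?r)"
      by (simp only: update_cell_def code6_iff[OF code])
    have "\<exists>x<n. update_cell \<delta> n z d x"
    proof (cases "d ?l \<or> d ?r")
      case True
      then show ?thesis unfolding upd using lr ne by (metis fun_upd_other)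
    next
      case False
      then have "update_cell \<delta> n z d y"
        unfolding upd using y by (cases "y = z") simp_all
      then show ?thesis using y by blast
    qed
    then show ?case by (simp add: nonzero_configs_def d_def z_def)
  qed
  with zero show "\<not> same_config n (config_at \<delta> n (\<lambda>_. False) \<omega> t) (config_at \<delta> n c \<omega> t)"
    by (auto simp: same_config_def nonzero_configs_def)
qed

lemma code7_single_cell_never_coalesces:
  assumes code: "wolfram_code \<delta> = 7" and c: "c 0 \<noteq> c' 0"
  shows "expected_coalescence_time \<delta> 1 c c' = \<infinity>"
proof (rule expected_coalescence_time_infinite)
  fix \<omega> t
  have "config_at \<delta> 1 c \<omega> t 0 \<noteq> config_at \<delta> 1 c' \<omega> t 0"
    by (induction t) (use c in \<open>auto simp: update_cell_def code7_iff[OF code]\<close>)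
  then show "\<not> same_config 1 (config_at \<delta> 1 c \<omega> t) (config_at \<delta> 1 c' \<omega> t)"
    by (auto simp: same_config_def)
qed

end

theory Submission
  imports Defs
begin

text \<open>
  Call a pair of equal adjacent cells a defect. Since \<open>n\<close> is odd, the number of defects is odd, and
  it never increases: an update either moves a defect to an adjacent pair, turning \<open>00\<close> into \<open>11\<close>
  or back, or annihilates two adjacent defects of the same type. A defect \<open>00\<close> moves right at
  rate 1, and a defect \<open>11\<close> moves right and left at rate 1 each. Hence \<open>x - 1/3\<close> (for \<open>11\<close>)
  resp. \<open>x\<close> (for \<open>00\<close>) drifts with the same speed for both types, where \<open>x\<close> is the position,
  and the distance of two defects in this coordinate is a martingale.

  So a strictly concave function of the distance decreases in expectation, except at short distances,
  where it is corrected by hand. With at least three defects in one of the two configurations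
  this is applied to two consecutive defects of that configuration, and annihilation occurs in
  polynomial time. With one defect in each, it is applied to the pair consisting of these two
  defects, which live on the cycle of length \<open>2 * n\<close> that covers the ring twice (position and type);
  they coincide exactly when the configurations do. Taking minima over all such pairs keeps the
  supermartingale property, and adding a large multiple of the number of defects yields one
  Lyapunov function.
\<close>

section \<open>Expected time from a drift condition\<close>

lemma config_at_Stream:
  "config_at \<delta> n c (z ## \<omega>) (Suc t) = config_at \<delta> n (update_cell \<delta> n z c) \<omega> t"
  by (induction t) simp_all

lemma measurable_config_at [measurable]:
  "(\<lambda>\<omega>. config_at \<delta> n c \<omega> t) \<in> measurable (update_sequences n) (count_space UNIV)"
proof (induction t)
  case (Suc t)
  have "(\<lambda>\<omega>. \<omega> !! t) \<in> measurable (update_sequences n) (measure_pmf (pmf_of_set {..<n}))"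
    unfolding update_sequences_def by (rule measurable_snth)
  then have g: "(\<lambda>\<omega>. \<omega> !! t) \<in> measurable (update_sequences n) (count_space UNIV)"
    by simp
  have "(\<lambda>\<omega>. update_cell \<delta> n i (config_at \<delta> n c \<omega> t))
      \<in> measurable (update_sequences n) (count_space UNIV)" for i
    by (rule measurable_compose[OF Suc]) simp
  from measurable_compose_countable[OF this g] show ?case by simp
qed simp

text \<open>Every time before the first meeting adds 1 to the series, and every time does so if
  there is no meeting. The series has the advantage that its expectation can be taken term by
  term.\<close>

lemma coalescence_time_le_suminf:
  "coalescence_time \<delta> n c c' \<omega>
     \<le> (\<Sum>t. of_bool (\<not> same_config n (config_at \<delta> n c \<omega> t) (config_at \<delta> n c' \<omega> t)))"
    (is "_ \<le> suminf ?D")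
proof -
  let ?S = "{t. same_config n (config_at \<delta> n c \<omega> t) (config_at \<delta> n c' \<omega> t)}"
  have le: "of_nat N \<le> suminf ?D" if "\<And>t. t < N \<Longrightarrow> t \<notin> ?S" for N
  proof -
    have "of_nat N = (\<Sum>t<N. ?D t)" using that by simp
    also have "\<dots> \<le> suminf ?D" by (rule sum_le_suminf) auto
    finally show ?thesis .
  qed
  show ?thesis
  proof (cases "?S = {}")
    case True
    then have "\<And>N. of_nat N \<le> suminf ?D" by (intro le) blast
    then have "suminf ?D = top"
      using ennreal_Ex_less_of_nat by (metis less_top not_less)
    then show ?thesis by simp
  next
    case False
    define T where "T = (LEAST t. t \<in> ?S)"
    have "T \<in> ?S" unfolding T_def using False by (meson LeastI ex_in_conv)
    then have "coalescence_time \<delta> n c c' \<omega> \<le> of_nat T"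
      unfolding coalescence_time_def by (rule INF_lower)
    also have "\<dots> \<le> suminf ?D"
      using not_less_Least[where P = "\<lambda>t. t \<in> ?S"] by (intro le) (auto simp: T_def)
    finally show ?thesis .
  qed
qed

text \<open>Divided by \<open>n\<close>, the drift condition says that \<open>V\<close> loses
  \<open>1 / n\<close> on average as long as the configurations differ. The total expected loss is
  at most the initial \<open>V\<close>, which bounds the expected number of such times. The
  telescoping is done by induction on the horizon \<open>N\<close>, conditioning on the first
  updated cell.\<close>

lemma expected_coalescence_time_le_drift:
  fixes V :: "configuration \<Rightarrow> configuration \<Rightarrow> nat"
  assumes n: "n > 0"
    and inv: "\<And>c c' z. I c c' \<Longrightarrow> z < n \<Longrightarrow> I (update_cell \<delta> n z c) (update_cell \<delta> n z c')"
    and drift: "\<And>c c'. I c c' \<Longrightarrow>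
      (\<Sum>z<n. V (update_cell \<delta> n z c) (update_cell \<delta> n z c')) + of_bool (\<not> same_config n c c')
        \<le> n * V c c'"
    and "I c c'"
  shows "expected_coalescence_time \<delta> n c c' \<le> of_nat (n * V c c')"
proof -
  let ?S = "update_sequences n"
  define D :: "nat \<Rightarrow> configuration \<Rightarrow> configuration \<Rightarrow> nat stream \<Rightarrow> ennreal" where
    "D t c c' \<omega> = of_bool (\<not> same_config n (config_at \<delta> n c \<omega> t) (config_at \<delta> n c' \<omega> t))"
    for t c c' \<omega>
  interpret U: prob_space ?S
    unfolding update_sequences_def
    by (rule prob_space.prob_space_stream_space[OF prob_space_measure_pmf])
  have D_meas [measurable]: "D t c c' \<in> borel_measurable ?S" for t c c'
  proof -
    have "(\<lambda>\<omega>. (config_at \<delta> n c \<omega> t) z) \<in> measurable ?S (count_space UNIV)" for c z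
      by (rule measurable_compose[OF measurable_config_at]) simp
    then have [measurable]: "Measurable.pred ?S (\<lambda>\<omega>. config_at \<delta> n c \<omega> t z)" for c z .
    have "Measurable.pred ?S (\<lambda>\<omega>. \<not> (\<forall>z\<in>{..<n}. config_at \<delta> n c \<omega> t z = config_at \<delta> n c' \<omega> t z))"
      by (intro pred_intros_logic pred_intros_finite) simp_all
    from measurable_compose[OF this, of "of_bool :: bool \<Rightarrow> ennreal" borel]
    show ?thesis unfolding D_def same_config_def by simp
  qed
  have first: "(\<integral>\<^sup>+\<omega>. D 0 c c' \<omega> \<partial>?S) = of_bool (\<not> same_config n c c')" for c c'
    by (simp add: D_def U.emeasure_space_1)
  have step: "(\<integral>\<^sup>+\<omega>. D (Suc t) c c' \<omega> \<partial>?S)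
      = (\<Sum>z<n. \<integral>\<^sup>+\<omega>. D t (update_cell \<delta> n z c) (update_cell \<delta> n z c') \<omega> \<partial>?S) / of_nat n" for t c c'
  proof -
    have "(\<integral>\<^sup>+\<omega>. D (Suc t) c c' \<omega> \<partial>?S)
        = (\<integral>\<^sup>+z. (\<integral>\<^sup>+\<omega>. D (Suc t) c c' (z ## \<omega>) \<partial>?S) \<partial>measure_pmf (pmf_of_set {..<n}))"
      using D_meas[of "Suc t" c c'] unfolding update_sequences_def
      by (rule prob_space.nn_integral_stream_space[OF prob_space_measure_pmf])
    also have "\<dots> = (\<integral>\<^sup>+z. (\<integral>\<^sup>+\<omega>. D t (update_cell \<delta> n z c) (update_cell \<delta> n z c') \<omega> \<partial>?S)
        \<partial>measure_pmf (pmf_of_set {..<n}))"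
      unfolding D_def config_at_Stream ..
    finally show ?thesis
      using n by (simp add: nn_integral_pmf_of_set lessThan_empty_iff)
  qed
  have "(\<Sum>t<N. \<integral>\<^sup>+\<omega>. D t c c' \<omega> \<partial>?S) \<le> of_nat (n * V c c')" if "I c c'" for N c c'
    using that
  proof (induction N arbitrary: c c')
    case (Suc N)
    let ?u = "\<lambda>z. update_cell \<delta> n z"
    have "(\<Sum>t<Suc N. \<integral>\<^sup>+\<omega>. D t c c' \<omega> \<partial>?S)
        = of_bool (\<not> same_config n c c')
          + (\<Sum>z<n. \<Sum>t<N. \<integral>\<^sup>+\<omega>. D t (?u z c) (?u z c') \<omega> \<partial>?S) / of_nat n"
      unfolding sum.lessThan_Suc_shift first step
      by (subst sum.swap) (simp add: divide_ennreal_def sum_distrib_right)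
    also have "\<dots> \<le> of_bool (\<not> same_config n c c')
          + (\<Sum>z<n. of_nat (n * V (?u z c) (?u z c'))) / of_nat n"
      using Suc inv by (intro add_left_mono divide_right_mono_ennreal sum_mono) auto
    also have "(\<Sum>z<n. of_nat (n * V (?u z c) (?u z c'))) / (of_nat n :: ennreal)
        = of_nat (\<Sum>z<n. V (?u z c) (?u z c'))"
    proof -
      have "(\<Sum>z<n. of_nat (n * V (?u z c) (?u z c')))
          = of_nat (\<Sum>z<n. V (?u z c) (?u z c')) * (of_nat n :: ennreal)"
        by (simp add: sum_distrib_left mult.commute)
      then show ?thesis using n by (simp add: mult_divide_eq_ennreal)
    qed
    also have "of_bool (\<not> same_config n c c') + of_nat (\<Sum>z<n. V (?u z c) (?u z c'))
        = (of_nat ((\<Sum>z<n. V (?u z c) (?u z c')) + of_bool (\<not> same_config n c c')) :: ennreal)"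
      by (simp add: add.commute)
    also have "\<dots> \<le> of_nat (n * V c c')"
      using drift[OF Suc.prems] by (simp only: of_nat_le_iff)
    finally show ?case .
  qed simp
  then have "(\<Sum>t. \<integral>\<^sup>+\<omega>. D t c c' \<omega> \<partial>?S) \<le> of_nat (n * V c c')"
    using \<open>I c c'\<close> by (intro suminf_le_const) auto
  moreover have "expected_coalescence_time \<delta> n c c' \<le> (\<integral>\<^sup>+\<omega>. (\<Sum>t. D t c c' \<omega>) \<partial>?S)"
    unfolding expected_coalescence_time_def D_def
    by (intro nn_integral_mono coalescence_time_le_suminf)
  moreover have "\<dots> = (\<Sum>t. \<integral>\<^sup>+\<omega>. D t c c' \<omega> \<partial>?S)"
    by (rule nn_integral_suminf) simp
  ultimately show ?thesis by simp
qed

section \<open>Defects\<close>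

text \<open>Code 6 for \<open>b = False\<close>, code 7 for \<open>b = True\<close>: they differ only on the neighbourhood \<open>000\<close>.\<close>

definition rule67 :: "bool \<Rightarrow> local_rule" where
  "rule67 b l s r \<longleftrightarrow> \<not> l \<and> (if r then \<not> s else s \<or> b)"

section \<open>The dynamic lifted to periodic functions on the integers\<close>

locale odd_ring =
  fixes n :: nat and b :: bool
  assumes n_odd: "odd n" and n_ge: "n \<ge> 3"
begin

text \<open>Configurations become functions on the integers, so that blocks of cells may run across
  the seam of the ring without modular indices. Correspondingly, \<open>step\<close> updates all
  representatives of a cell at once.\<close>

definition periodic :: "(int \<Rightarrow> bool) \<Rightarrow> bool" where
  "periodic u \<longleftrightarrow> (\<forall>x. u (x + int n) = u x)"

text \<open>The zero configuration has to be excluded for code 6, where it is a fixed point.\<close>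

definition valid :: "(int \<Rightarrow> bool) \<Rightarrow> bool" where
  "valid u \<longleftrightarrow> periodic u \<and> (b \<or> (\<exists>x. u x))"

definition step :: "int \<Rightarrow> (int \<Rightarrow> bool) \<Rightarrow> int \<Rightarrow> bool" where
  "step z u x = (if int n dvd x - z then rule67 b (u (x - 1)) (u x) (u (x + 1)) else u x)"

lemma periodic_mult:
  assumes "periodic u"
  shows "u (x + int n * k) = u x"
proof -
  have nn: "u (x + int n * int k) = u x" for x k
  proof (induction k)
    case (Suc k)
    have "x + int n * int (Suc k) = (x + int n * int k) + int n" by (simp add: algebra_simps)
    then show ?case using Suc assms unfolding periodic_def by metis
  qed simp
  show ?thesis
  proof (cases k)
    case (neg m)
    then have "k + int (Suc m) = 0" by simp
    then have "x + int n * k + int n * int (Suc m) = x"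
      by (simp only: add.assoc distrib_left[symmetric] mult_zero_right add_0_right)
    then show ?thesis using nn[of "x + int n * k" "Suc m"] by metis
  qed (use nn in auto)
qed

lemma periodic_cong:
  assumes "periodic u" "int n dvd x - y"
  shows "u x = u y"
proof -
  obtain k where "x - y = int n * k" using assms(2) by (rule dvdE)
  then have "x = y + int n * k" by simp
  then show ?thesis using periodic_mult[OF assms(1)] by simp
qed

lemma periodic_step:
  assumes u: "periodic u"
  shows "periodic (step z u)"
  unfolding periodic_def
proof
  fix x
  have "x + int n - z = (x - z) + int n" by simp
  then have d: "int n dvd (x + int n) - z \<longleftrightarrow> int n dvd x - z"
    by (simp only: dvd_add_triv_right_iff)
  have "u (x + int n - 1) = u (x - 1)" by (rule periodic_cong[OF u]) simp
  moreover have "u (x + int n + 1) = u (x + 1)" by (rule periodic_cong[OF u]) simp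
  moreover have "u (x + int n) = u x" by (rule periodic_cong[OF u]) simp
  ultimately show "step z u (x + int n) = step z u x" unfolding step_def d by presburger
qed

lemma step_cong: "int n dvd z - z' \<Longrightarrow> step z u = step z' u"
proof -
  assume "int n dvd z - z'"
  then have "int n dvd x - z \<longleftrightarrow> int n dvd x - z'" for x
    using dvd_diff[of "int n" "x - z'" "z - z'"] dvd_add[of "int n" "x - z" "z - z'"] by auto
  then show ?thesis unfolding step_def by (intro ext) simp
qed

lemma dvd_small: "int n dvd x \<Longrightarrow> \<bar>x\<bar> < int n \<Longrightarrow> x = 0"
  using zdvd_imp_le[of "int n" "\<bar>x\<bar>"] by fastforce

text \<open>No other representative of \<open>z\<close> is closer than \<open>n\<close>, so locally
  the lifted update changes a single cell.\<close>

lemma step_near: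
  assumes "\<bar>x - z\<bar> < int n"
  shows "step z u x = (if x = z then rule67 b (u (z - 1)) (u z) (u (z + 1)) else u x)"
  using dvd_small[of "x - z"] assms unfolding step_def by auto

lemma step_id:
  assumes u: "periodic u" and "rule67 b (u (z - 1)) (u z) (u (z + 1)) = u z"
  shows "step z u = u"
proof
  fix x
  show "step z u x = u x"
  proof (cases "int n dvd x - z")
    case True
    then have "u x = u z" "u (x - 1) = u (z - 1)" "u (x + 1) = u (z + 1)"
      by (intro periodic_cong[OF u]; simp)+
    then show ?thesis using assms(2) by (simp add: step_def)
  qed (simp add: step_def)
qed

text \<open>For code 6, a 1 next to \<open>z\<close> survives the update. If both neighbours are 0,
  then a 1 at \<open>z\<close> is isolated and kept, and a 1 elsewhere is untouched.\<close>

lemma valid_step: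
  assumes "valid u"
  shows "valid (step z u)"
proof -
  have u: "periodic u" using assms by (simp add: valid_def)
  have "\<exists>x. step z u x" if "\<not> b"
  proof (cases "u (z - 1) \<or> u (z + 1)")
    case True
    have "step z u (z - 1) = u (z - 1)" "step z u (z + 1) = u (z + 1)"
      using n_ge by (simp_all add: step_near)
    then show ?thesis using True by metis
  next
    case False
    obtain x where x: "u x" using assms \<open>\<not> b\<close> unfolding valid_def by blast
    show ?thesis
    proof (cases "int n dvd x - z")
      case True
      then have "u z" using periodic_cong[OF u] x by blast
      then have "step z u = u" using False by (intro step_id[OF u]) (simp add: rule67_def)
      then show ?thesis using x by auto
    next
      case False
      then show ?thesis using x by (auto simp: step_def)
    qed
  qed
  then show ?thesis using periodic_step[OF u] unfolding valid_def by blast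
qed

lemma sum_shift:
  fixes f :: "int \<Rightarrow> 'a :: comm_monoid_add"
  assumes f: "\<And>x y. int n dvd x - y \<Longrightarrow> f x = f y"
  shows "sum f {0..<int n} = sum f {p..<p + int n}"
proof -
  have n0: "int n > 0" using n_ge by simp
  have m: "p + (x - p) mod int n \<in> {p..<p + int n}" for x using n0 by simp
  have dvd_rep: "int n dvd (p + (x - p) mod int n) - x" for x
    using mod_eq_dvd_iff[of "p + (x - p) mod int n" "int n" x] by (simp add: mod_add_right_eq)
  have uniq: "x = y" if "int n dvd x - y" "\<bar>x - y\<bar> < int n" for x y
    using dvd_small[OF that] by simp
  show ?thesis
  proof (rule sum.reindex_bij_witness[where j = "\<lambda>x. p + (x - p) mod int n" and i = "\<lambda>x. x mod int n"])
    fix a assume a: "a \<in> {0..<int n}"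
    show "p + (a - p) mod int n \<in> {p..<p + int n}" by (rule m)
    show "(p + (a - p) mod int n) mod int n = a" using a by (simp add: mod_add_right_eq)
    show "f (p + (a - p) mod int n) = f a" by (rule f[OF dvd_rep])
  next
    fix a assume a: "a \<in> {p..<p + int n}"
    show "a mod int n \<in> {0..<int n}" using n0 by simp
    have "(a mod int n - p) mod int n = (a - p) mod int n" by (simp add: mod_diff_left_eq)
    also have "\<dots> = a - p" using a by simp
    finally show "p + (a mod int n - p) mod int n = a" by simp
  qed
qed

section \<open>The number of defects\<close>

definition defects :: "(int \<Rightarrow> bool) \<Rightarrow> nat" where
  "defects u = (\<Sum>i\<in>{0..<int n}. of_bool (u i = u (i + 1)))"

lemma defects_shift:
  assumes "periodic u"
  shows "defects u = (\<Sum>i\<in>{p..<p + int n}. of_bool (u i = u (i + 1)))"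
  unfolding defects_def
proof (rule sum_shift)
  fix x y assume "int n dvd x - y"
  then have "u x = u y" "u (x + 1) = u (y + 1)" by (intro periodic_cong[OF assms]; simp)+
  then show "of_bool (u x = u (x + 1)) = of_bool (u y = u (y + 1))" by simp
qed

lemma defects_split:
  assumes "periodic u"
  shows "defects u = of_bool (u (z - 1) = u z) + of_bool (u z = u (z + 1))
    + (\<Sum>i\<in>{z + 1..<z - 1 + int n}. of_bool (u i = u (i + 1)))"
proof -
  have "{z - 1..<z - 1 + int n} = insert (z - 1) (insert z {z + 1..<z - 1 + int n})"
    using n_ge by auto
  then show ?thesis unfolding defects_shift[OF assms, of "z - 1"] by simp
qed

text \<open>Only the two edges at \<open>z\<close> can change. The balance is written additively
  because subtraction on \<open>nat\<close> truncates.\<close>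

lemma defects_step:
  assumes u: "periodic u" and v_def: "v = rule67 b (u (z - 1)) (u z) (u (z + 1))"
  shows "defects (step z u) + of_bool (u (z - 1) = u z) + of_bool (u z = u (z + 1))
    = defects u + of_bool (u (z - 1) = v) + of_bool (v = u (z + 1))"
proof -
  have "(\<Sum>i\<in>{z + 1..<z - 1 + int n}. of_bool (step z u i = step z u (i + 1)))
      = (\<Sum>i\<in>{z + 1..<z - 1 + int n}. of_bool (u i = u (i + 1)) :: nat)"
    by (intro sum.cong) (auto simp: step_near)
  moreover have "step z u (z - 1) = u (z - 1)" "step z u z = v" "step z u (z + 1) = u (z + 1)"
    using n_ge by (auto simp: step_near v_def)
  ultimately show ?thesis
    using defects_split[OF u, of z] defects_split[OF periodic_step[OF u], of z z] by simp
qed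

text \<open>A cell that differs from both neighbours is never flipped, so no flip creates two
  defects; a flip between unequal neighbours moves one defect.\<close>

lemma defects_step_le: "periodic u \<Longrightarrow> defects (step z u) \<le> defects u"
  using defects_step[of u _ z, OF _ refl]
  by (cases b; cases "u (z - 1)"; cases "u z"; cases "u (z + 1)") (auto simp: rule67_def)

text \<open>The middle cell of \<open>111\<close> always flips, that of \<open>000\<close> only for
  code 7.\<close>

lemma defects_annihilate:
  assumes "periodic u" "u (z - 1) = u z" "u (z + 1) = u z" "b \<or> u z"
  shows "defects (step z u) + 2 \<le> defects u"
  using defects_step[of u _ z, OF _ refl] assms by (cases "u z") (auto simp: rule67_def)

text \<open>Once around the ring the state changes an even number of times, namely at the edges
  without a defect, and \<open>n\<close> is odd.\<close>

lemma odd_defects: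
  assumes "periodic u"
  shows "odd (defects u)"
proof -
  have "even ((\<Sum>i\<in>{0..<int m}. of_bool (u i = u (i + 1))) + m :: nat) = (u 0 = u (int m))" for m
  proof (induction m)
    case (Suc m)
    have "{0..<int (Suc m)} = insert (int m) {0..<int m}" by auto
    then show ?case using Suc by (auto simp: add.commute)
  qed simp
  from this[of n] have "even (defects u + n)"
    using assms by (simp add: defects_def periodic_def) (metis add_0)
  then show ?thesis using n_odd by simp
qed

text \<open>
  Two consecutive defects at the edges \<open>(p, p + 1)\<close> and \<open>(p + m + 1, p + m + 2)\<close>, separated by an
  alternating block; \<open>s\<close> is the state of the two cells of the first one.
\<close>

definition segment :: "(int \<Rightarrow> bool) \<Rightarrow> int \<Rightarrow> nat \<Rightarrow> bool \<Rightarrow> bool" where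
  "segment u p m s \<longleftrightarrow> m + 2 \<le> n \<and> u p = s \<and> (\<forall>j\<le>m. u (p + 1 + int j) = (s \<noteq> odd j))
     \<and> u (p + int m + 2) = (s \<noteq> odd m)"

text \<open>For \<open>n = m + 2\<close> the last cell would be \<open>p\<close> again, but with the
  opposite state, because \<open>m\<close> is odd. The bound makes the cells from \<open>p\<close>
  to \<open>p + m + 2\<close> distinct on the ring.\<close>

lemma segment_length:
  assumes u: "periodic u" and seg: "segment u p m s"
  shows "m + 3 \<le> n"
proof (rule ccontr)
  assume "\<not> m + 3 \<le> n"
  with seg have n: "n = m + 2" by (auto simp: segment_def)
  then have "u (p + int m + 2) = u p" using u by (metis add.assoc periodic_def of_nat_add of_nat_numeral)
  moreover have "odd m" using n n_odd by simp
  ultimately show False using seg by (auto simp: segment_def)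
qed

lemma segment_ex:
  assumes "defects u \<ge> 3"
  shows "\<exists>p m s. segment u p m s"
proof -
  let ?E = "{i \<in> {0..<int n}. u i = u (i + 1)}"
  have fin: "finite ?E" by (rule finite_subset[of _ "{0..<int n}"]) auto
  have card: "card ?E \<ge> 3"
    using assms by (simp add: defects_def Int_def sum_of_bool_eq)
  define i where "i = Min ?E"
  have ne: "?E \<noteq> {}" using card by (metis card.empty not_numeral_le_zero)
  have i: "i \<in> ?E" unfolding i_def using fin ne by (rule Min_in)
  define E' where "E' = ?E - {i}"
  have card': "card E' \<ge> 2" unfolding E'_def using card i by (subst card_Diff_singleton) auto
  have "finite E'" using fin by (simp add: E'_def)
  have "E' \<noteq> {}" using card' by (metis card.empty not_numeral_le_zero)
  define j where "j = Min E'"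
  have j: "j \<in> E'" unfolding j_def using \<open>finite E'\<close> \<open>E' \<noteq> {}\<close> by (intro Min_in) auto
  have "card (E' - {j}) \<ge> 1" using card' j by (subst card_Diff_singleton) auto
  \<comment> \<open>\<open>j\<close> is the second smallest defect. The third one, \<open>l\<close>,
    lies to its right and keeps \<open>j\<close> off the end of the window, which yields
    \<open>m + 2 \<le> n\<close>.\<close>
  then obtain l where l: "l \<in> E'" "l \<noteq> j" by (metis DiffE card.empty ex_in_conv insertI1 not_one_le_zero)
  have lj: "j < l" using Min_le[OF \<open>finite E'\<close> l(1)] l(2) by (simp add: j_def)
  have ij: "i < j" using Min_le[OF fin, of j] j by (auto simp: E'_def i_def)
  have between: "u x \<noteq> u (x + 1)" if "i < x" "x < j" for x
  proof
    assume "u x = u (x + 1)"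
    then have "x \<in> E'" using that i l(1) lj by (auto simp: E'_def)
    then show False using Min_le[OF \<open>finite E'\<close>, of x] that by (simp add: j_def)
  qed
  define m where "m = nat (j - i - 1)"
  have m: "int m = j - i - 1" using ij by (simp add: m_def)
  have alt: "u (i + 1 + int k) = (u i \<noteq> odd k)" if "k \<le> m" for k
    using that
  proof (induction k)
    case 0
    then show ?case using i by simp
  next
    case (Suc k)
    have "u (i + 1 + int k) \<noteq> u (i + 1 + int k + 1)"
      using Suc.prems m by (intro between) auto
    then show ?case using Suc by (auto simp: algebra_simps)
  qed
  have "segment u i m (u i)"
    unfolding segment_def
  proof (intro conjI allI impI)
    show "m + 2 \<le> n" using m i l(1) lj by (auto simp: E'_def)
    have "u j = u (j + 1)" using j by (simp add: E'_def)
    moreover have e: "i + 1 + int m = j" "i + int m + 2 = j + 1" using m by auto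
    moreover have "u j = (u i \<noteq> odd m)" using alt[of m] unfolding e by simp
    ultimately show "u (i + int m + 2) = (u i \<noteq> odd m)" unfolding e(2) by blast
  qed (use alt in auto)
  then show ?thesis by blast
qed

text \<open>
  The only defect is at the edge \<open>(q, q + 1)\<close>; the parity of \<open>q\<close> encodes its type, and as \<open>n\<close> is odd,
  \<open>q\<close> matters modulo \<open>2 * n\<close> only.
\<close>

definition window :: "(int \<Rightarrow> bool) \<Rightarrow> int \<Rightarrow> bool" where
  "window u q \<longleftrightarrow> (\<forall>x. q < x \<and> x \<le> q + int n \<longrightarrow> u x = even x)"

text \<open>Around the defect the states read \<open>not s, s, s, not s\<close>. Cell
  \<open>q + 1\<close> always flips, cell \<open>q\<close> only if \<open>s\<close> is 1, that is
  for odd \<open>q\<close>. Each move changes the parity of \<open>q\<close> and hence the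
  type.\<close>

definition move :: "int \<Rightarrow> int \<Rightarrow> int" where
  "move z q = (if int n dvd z - (q + 1) then q + 1
     else if int n dvd z - q \<and> odd q then q - 1 else q)"

lemma window_ex:
  assumes u: "periodic u" and "defects u < 3"
  shows "\<exists>q. window u q"
proof -
  have "k = 1" if "odd k" "k < 3" for k :: nat using that by presburger
  then have "defects u = 1" using odd_defects[OF u] assms(2) by blast
  then have "card {i \<in> {0..<int n}. u i = u (i + 1)} = 1"
    by (simp add: defects_def Int_def sum_of_bool_eq)
  then obtain i where E: "{i \<in> {0..<int n}. u i = u (i + 1)} = {i}" by (rule card_1_singletonE)
  then have "i \<in> {i \<in> {0..<int n}. u i = u (i + 1)}" by blast
  then have i: "i \<in> {0..<int n}" "u i = u (i + 1)" by blast+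
  have alt: "u x \<noteq> u (x + 1)" if "\<not> int n dvd x - i" for x
  proof
    assume eq: "u x = u (x + 1)"
    have d: "int n dvd x mod int n - x"
      using mod_eq_dvd_iff[of "x mod int n" "int n" x] by simp
    have "u (x mod int n) = u x" "u (x mod int n + 1) = u (x + 1)"
      using d by (intro periodic_cong[OF u]; simp)+
    then have "x mod int n \<in> {i \<in> {0..<int n}. u i = u (i + 1)}" using eq n_ge by simp
    then have "x mod int n = i" using E by blast
    then show False using d that by (metis dvd_diff_commute)
  qed
  \<comment> \<open>Adding the odd number \<open>n\<close> changes the parity, so one of these two
    lifts of the edge \<open>i\<close> has the parity that encodes its type.\<close>
  define q where "q = (if u i = odd i then i else i + int n)"
  have q: "int n dvd q - i" "odd q = u i" using n_odd by (auto simp: q_def)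
  have "u (q + 1 + int j) = even (q + 1 + int j)" if "j < n" for j
    using that
  proof (induction j)
    case 0
    have "u (q + 1) = u (i + 1)" using q(1) by (intro periodic_cong[OF u]) simp
    then show ?case using q(2) i(2) by auto
  next
    case (Suc j)
    have "\<not> int n dvd (q + 1 + int j) - i"
    proof
      assume "int n dvd (q + 1 + int j) - i"
      from dvd_diff[OF this q(1)] have "int n dvd int (j + 1)" by (simp add: algebra_simps)
      then show False using dvd_small[of "int (j + 1)"] Suc.prems by auto
    qed
    from alt[OF this] have "u (q + 1 + int j) \<noteq> u (q + 1 + int (Suc j))" by (simp add: algebra_simps)
    then show ?case using Suc by auto
  qed
  note rep = this
  have "u x = even x" if "q < x" "x \<le> q + int n" for x
  proof -
    have "q + 1 + int (nat (x - q - 1)) = x" "nat (x - q - 1) < n" using that by linarith+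
    then show ?thesis using rep[of "nat (x - q - 1)"] by simp
  qed
  then show ?thesis unfolding window_def by blast
qed

text \<open>A window is a full period, so \<open>q\<close> determines the configuration: two
  single-defect configurations agree once their defects meet.\<close>

lemma window_unique:
  assumes "periodic u" "periodic u'" "window u q" "window u' q"
  shows "u = u'"
proof
  fix x
  define y where "y = q + 1 + (x - (q + 1)) mod int n"
  have "int n dvd y - x"
    using mod_eq_dvd_iff[of y "int n" x] by (simp add: y_def mod_add_right_eq)
  then have "u x = u y" "u' x = u' y" using assms periodic_cong by metis+
  moreover have "q < y" "y \<le> q + int n"
    using pos_mod_bound[of "int n" "x - (q + 1)"] pos_mod_sign[of "int n" "x - (q + 1)"] n_ge
    unfolding y_def by linarith+
  ultimately show "u x = u' x" using assms by (simp add: window_def)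
qed

lemma window_shift:
  assumes "periodic u" "window u q"
  shows "window u (q + 2 * int n * k)"
  unfolding window_def
proof (intro allI impI)
  fix x assume x: "q + 2 * int n * k < x \<and> x \<le> q + 2 * int n * k + int n"
  have "u (x - 2 * int n * k) = even (x - 2 * int n * k)"
    using assms(2) x by (simp add: window_def)
  moreover have "u x = u (x - 2 * int n * k)" by (intro periodic_cong[OF assms(1)]) simp
  ultimately show "u x = even x" by simp
qed

text \<open>Modulo \<open>n\<close>, every cell other than \<open>q\<close> and \<open>q + 1\<close>
  differs from both neighbours and is stable.\<close>

lemma window_step:
  assumes u: "periodic u" and w: "window u q"
  shows "window (step z u) (move z q)"
proof -
  have val: "u x = even x" if "q < x" "x \<le> q + int n" for x using w that by (simp add: window_def)
  \<comment> \<open>\<open>q\<close> and \<open>q - 1\<close> lie outside the window; translating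
    them into it by the odd number \<open>n\<close> swaps the parity.\<close>
  have uq: "u q = odd q"
  proof -
    have "u q = u (q + int n)" using u by (simp add: periodic_def)
    then show ?thesis using val[of "q + int n"] n_ge n_odd by simp
  qed
  have uq': "u (q - 1) = even q"
  proof -
    have "u (q - 1) = u (q - 1 + int n)" using u by (simp add: periodic_def)
    then show ?thesis using val[of "q - 1 + int n"] n_ge n_odd by auto
  qed
  have uq1: "u (q + 1) = odd q" "u (q + 2) = even q" using val n_ge by auto
  have near: "step y u x = (if x = y then \<not> u y else u x)"
    if "\<bar>x - y\<bar> < int n" "rule67 b (u (y - 1)) (u y) (u (y + 1)) \<noteq> u y" for x y
    using step_near[OF that(1)] that(2) by auto
  consider "int n dvd z - (q + 1)" | "\<not> int n dvd z - (q + 1)" "int n dvd z - q"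
    | "\<not> int n dvd z - (q + 1)" "\<not> int n dvd z - q" by blast
  then show ?thesis
  proof cases
    case 1
    have flip: "rule67 b (u (q + 1 - 1)) (u (q + 1)) (u (q + 1 + 1)) \<noteq> u (q + 1)"
      using uq uq1 by (auto simp: rule67_def algebra_simps)
    have "step (q + 1) u x = even x" if "q + 1 < x" "x \<le> q + 1 + int n" for x
    proof (cases "x = q + 1 + int n")
      case True
      have "step (q + 1) u x = step (q + 1) u (q + 1)"
        using periodic_step[OF u] True by (simp add: periodic_def)
      also have "\<dots> = (\<not> u (q + 1))" using near[OF _ flip, of "q + 1"] n_ge by simp
      finally show ?thesis using True uq1 n_odd by auto
    next
      case False
      then show ?thesis using near[OF _ flip, of x] that val by auto
    qed
    then have "window (step (q + 1) u) (q + 1)" by (simp add: window_def)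
    then show ?thesis using 1 step_cong[OF 1] by (simp add: move_def)
  next
    case 2
    show ?thesis
    proof (cases "odd q")
      case True
      have flip: "rule67 b (u (q - 1)) (u q) (u (q + 1)) \<noteq> u q"
        using uq uq' uq1 True by (auto simp: rule67_def)
      have "step q u x = even x" if "q - 1 < x" "x \<le> q - 1 + int n" for x
        using near[OF _ flip, of x] that val uq True by (cases "x = q") auto
      then have "window (step q u) (q - 1)" by (simp add: window_def)
      then show ?thesis using 2 True step_cong[OF 2(2)] by (simp add: move_def)
    next
      case False
      have "step q u = u" using uq uq' uq1 False by (intro step_id[OF u]) (auto simp: rule67_def)
      then show ?thesis using 2 False step_cong[OF 2(2)] w by (simp add: move_def)
    qed
  next
    case 3
    define y where "y = q + (z - q) mod int n"
    have zy: "int n dvd z - y"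
      using mod_eq_dvd_iff[of z "int n" y] by (simp add: y_def mod_add_right_eq)
    have "y \<noteq> q" "y \<noteq> q + 1" using 3 zy by auto
    moreover have "q \<le> y" "y < q + int n"
      using pos_mod_bound[of "int n" "z - q"] pos_mod_sign[of "int n" "z - q"] n_ge
      unfolding y_def by linarith+
    ultimately have "u (y - 1) = even (y - 1)" "u y = even y" "u (y + 1) = even (y + 1)"
      using val[of "y - 1"] val[of y] val[of "y + 1"] by linarith+
    then have "step y u = u" by (intro step_id[OF u]) (auto simp: rule67_def)
    then show ?thesis using 3 step_cong[OF zy] w by (simp add: move_def)
  qed
qed

section \<open>The potential of a pair of defects\<close>

text \<open>A parabola with second difference -2, increasing up to \<open>6 * n\<close>, while gaps
  do not exceed \<open>3 * n + 1\<close>.\<close>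

definition profile :: "int \<Rightarrow> int" where
  "profile x = 1000 * int n + x * (12 * int n - x)"

text \<open>Twice the distance in the coordinate with uniform drift, in units in which the speed is 1.\<close>

definition gap :: "nat \<Rightarrow> bool \<Rightarrow> int" where
  "gap m s = 3 * int m + of_bool s - of_bool (s \<noteq> odd m)"

text \<open>
  The values at \<open>m \<le> 1\<close> absorb the interaction of close defects. They solve the finitely many
  inequalities that arise there, the large constant term of \<open>profile\<close> giving the necessary room.
\<close>

definition pot :: "int \<Rightarrow> int \<Rightarrow> nat \<Rightarrow> bool \<Rightarrow> int" where
  "pot a c m s = (if m = 0 then if s then 0 else a
     else if m = 1 then if s then 1000 * int n else c
     else profile (gap m s))"

text \<open>Here \<open>m\<close> is the distance of the defects minus one. For an adjacent pair
  \<open>00\<close> the only change counted below is the move of the right defect to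
  \<open>m = 1\<close>, which therefore gets the smaller value \<open>800 * n\<close>.\<close>

abbreviation pot_same :: "nat \<Rightarrow> bool \<Rightarrow> int" where
  "pot_same \<equiv> pot (801 * int n) (800 * int n)"

text \<open>Here \<open>m\<close> is the distance itself, and 0 means that the configurations agree.
  At distance 1 with \<open>00\<close> on the left, an update of the common active cell only swaps
  the defects, and the other move leads to distance 2 with value \<open>profile 6\<close>; hence the
  \<open>+ 1\<close>.\<close>

abbreviation pot_cross :: "nat \<Rightarrow> bool \<Rightarrow> int" where
  "pot_cross \<equiv> pot 0 (profile 6 + 1)"

text \<open>Bounds the values of both potentials and is the price of one defect in
  \<open>lyapunov\<close>.\<close>

definition max_pot :: nat where
  "max_pot = 2000 * n ^ 2"

lemma profile_bounds:
  assumes "0 \<le> x" "x \<le> 12 * int n"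
  shows "0 \<le> profile x" "profile x < int max_pot"
proof -
  show "0 \<le> profile x" using assms by (simp add: profile_def)
  have "0 \<le> (6 * int n - x) ^ 2" by simp
  then have "profile x \<le> 1000 * int n + 36 * int n ^ 2"
    by (simp add: profile_def power2_eq_square algebra_simps)
  moreover have "3 * int n \<le> int n ^ 2" using n_ge by (simp add: power2_eq_square)
  ultimately show "profile x < int max_pot" using n_ge by (simp add: max_pot_def)
qed

lemma gap_bounds: "3 * int m - 1 \<le> gap m s" "gap m s \<le> 3 * int m + 1"
  by (auto simp: gap_def)

lemma pot_bounds:
  assumes "m \<le> n" "0 \<le> a" "0 \<le> c" "a \<le> int max_pot" "c \<le> int max_pot"
  shows "0 \<le> pot a c m s" "pot a c m s \<le> int max_pot"
proof -
  have "0 \<le> profile (gap m s)" "profile (gap m s) < int max_pot" if "m \<noteq> 0"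
    using that gap_bounds[of m s] assms(1) n_ge by (intro profile_bounds; linarith)+
  moreover have "1000 * int n < int max_pot"
    using profile_bounds(2)[of 0] by (simp add: profile_def)
  ultimately show "0 \<le> pot a c m s" "pot a c m s \<le> int max_pot"
    using assms by (auto simp: pot_def less_imp_le)
qed

lemma pot_same_bounds:
  assumes "m \<le> n"
  shows "0 \<le> pot_same m s" "pot_same m s \<le> int max_pot"
proof -
  have "1000 * int n < int max_pot"
    using profile_bounds(2)[of 0] by (simp add: profile_def)
  then show "0 \<le> pot_same m s" "pot_same m s \<le> int max_pot"
    using assms by (intro pot_bounds; simp)+
qed

lemma pot_cross_bounds:
  assumes "m \<le> n"
  shows "0 \<le> pot_cross m s" "pot_cross m s \<le> int max_pot"
proof -
  have "0 \<le> profile 6" "profile 6 < int max_pot"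
    using n_ge by (intro profile_bounds; simp)+
  then show "0 \<le> pot_cross m s" "pot_cross m s \<le> int max_pot"
    using assms by (intro pot_bounds; simp)+
qed

text \<open>
  The changes of the potential when the left defect moves left or right and when the right defect moves
  left or right; \<open>- int max_pot\<close> stands for an annihilation.
\<close>

definition left_out :: "nat \<Rightarrow> bool \<Rightarrow> int" where
  "left_out m s = (if s then pot_same (m + 1) False - pot_same m s else 0)"
definition left_in :: "nat \<Rightarrow> bool \<Rightarrow> int" where
  "left_in m s = (if m = 0 then if s then - int max_pot else 0 else pot_same (m - 1) (\<not> s) - pot_same m s)"
definition right_in :: "nat \<Rightarrow> bool \<Rightarrow> int" where
  "right_in m s = (if m \<noteq> 0 \<and> s \<noteq> odd m then pot_same (m - 1) s - pot_same m s else 0)"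
definition right_out :: "nat \<Rightarrow> bool \<Rightarrow> int" where
  "right_out m s = pot_same (m + 1) s - pot_same m s"

lemmas change_defs = left_out_def left_in_def right_in_def right_out_def

text \<open>Summed over its moves, the left defect changes \<open>gap\<close> by -2 and the right
  one by 2, whatever their types. So the linear part of \<open>profile\<close> cancels and the
  square leaves a negative rest. For \<open>m \<le> 2\<close> the special values of
  \<open>pot\<close> enter.\<close>

lemma pot_same_drift:
  assumes "m + 3 \<le> n"
  shows "left_out m s + left_in m s + right_in m s + right_out m s \<le> - 1"
proof -
  consider "m = 0" | "m = 1" | "m = 2" | k where "m = Suc (Suc (Suc k))"
    by (metis One_nat_def Suc_1 not0_implies_Suc)
  then show ?thesis
  proof cases
    case 1
    have "3 * int n \<le> int n ^ 2" using n_ge by (simp add: power2_eq_square)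
    then show ?thesis unfolding 1 using n_ge
      by (cases s) (simp_all add: change_defs pot_def max_pot_def)
  next
    case 2
    show ?thesis unfolding 2 using n_ge
      by (cases s) (simp_all add: change_defs pot_def profile_def gap_def)
  next
    case 3
    show ?thesis unfolding 3 using n_ge
      by (cases s) (simp_all add: change_defs pot_def profile_def gap_def)
  next
    case 4
    show ?thesis unfolding 4
      by (cases s; cases "odd k") (simp_all add: change_defs pot_def profile_def gap_def algebra_simps)
  qed
qed

text \<open>Covers the moves of a right defect \<open>00\<close> that are blocked for code 6:
  replacing their change by 0 does not raise the sum. At \<open>m = 0\<close> this fails, the change
  being \<open>- n\<close>.\<close>

lemma right_out_nonneg:
  assumes "m + 3 \<le> n" "m \<noteq> 0" "s = odd m"
  shows "0 \<le> right_out m s"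
proof -
  consider "m = 1" | k where "m = Suc (Suc k)"
    using assms(2) by (metis One_nat_def not0_implies_Suc)
  then show ?thesis
  proof cases
    case 1
    then show ?thesis using n_ge assms by (simp add: right_out_def pot_def profile_def gap_def)
  next
    case 2
    show ?thesis unfolding 2 using assms 2
      by (cases s; cases "odd k") (simp_all add: right_out_def pot_def profile_def gap_def algebra_simps)
  qed
qed

lemma change_ge:
  assumes "m + 3 \<le> n"
  shows "- int max_pot \<le> left_out m s" "- int max_pot \<le> left_in m s"
    "- int max_pot \<le> right_in m s" "- int max_pot \<le> right_out m s"
proof -
  have "- int max_pot \<le> pot_same i s - pot_same j s'" if "i \<le> n" "j \<le> n" for i j s s'
    using pot_same_bounds[OF that(1), of s] pot_same_bounds[OF that(2), of s'] by linarith
  then show "- int max_pot \<le> left_out m s" "- int max_pot \<le> left_in m s"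
    "- int max_pot \<le> right_in m s" "- int max_pot \<le> right_out m s"
    using assms by (auto simp: change_defs)
qed

text \<open>For \<open>m = 0\<close> the two middle positions coincide; \<open>right_in\<close> then
  vanishes and \<open>left_in\<close> alone counts that cell.\<close>

definition change_at :: "int \<Rightarrow> nat \<Rightarrow> bool \<Rightarrow> int \<Rightarrow> int" where
  "change_at p m s z = (if z = p then left_out m s else 0) + (if z = p + 1 then left_in m s else 0)
     + (if z = p + int m + 1 then right_in m s else 0) + (if z = p + int m + 2 then right_out m s else 0)"

lemma sum_change_at:
  assumes "m + 3 \<le> n"
  shows "(\<Sum>z\<in>{p..<p + int n}. change_at p m s z) \<le> - 1"
proof -
  have "(\<Sum>z\<in>{p..<p + int n}. change_at p m s z) = left_out m s + left_in m s + right_in m s + right_out m s"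
    using assms by (simp add: change_at_def sum.distrib)
  then show ?thesis using pot_same_drift[OF assms] by simp
qed

text \<open>
  A right defect \<open>00\<close> followed by a third 0 is blocked for code 6. This only lowers the expected
  change, unless the left defect cannot move either, which is the case that \<open>unblocked\<close> excludes.
\<close>

lemma segment_step:
  assumes u: "periodic u" and seg: "segment u p m s"
    and unblocked: "m = 0 \<and> \<not> s \<longrightarrow> b \<or> u (p + 3)"
    and z: "z \<in> {p..<p + int n}"
  shows "defects (step z u) + 2 \<le> defects u \<and> - int max_pot \<le> change_at p m s z
    \<or> (\<exists>p' m' s'. segment (step z u) p' m' s' \<and> pot_same m' s' \<le> pot_same m s + change_at p m s z)"
    (is "?A \<or> ?B")
proof -
  have mn: "m + 3 \<le> n" by (rule segment_length[OF u seg])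
  have first: "u p = s" and alt: "\<And>j. j \<le> m \<Longrightarrow> u (p + 1 + int j) = (s \<noteq> odd j)"
    and last: "u (p + int m + 2) = (s \<noteq> odd m)"
    using seg by (auto simp: segment_def)
  have snd: "u (p + 1) = s" using alt[of 0] by simp
  have pen: "u (p + int m + 1) = (s \<noteq> odd m)" using alt[of m] by (simp add: algebra_simps)
  have stay: ?B if "step z u = u" "0 \<le> change_at p m s z"
    using that seg by (intro exI[of _ p] exI[of _ m] exI[of _ s]) simp
  have flip: "step z u x = (if x = z then \<not> u z else u x)"
    if "\<bar>x - z\<bar> < int n" "rule67 b (u (z - 1)) (u z) (u (z + 1)) \<noteq> u z" for x
    using step_near[OF that(1)] that(2) by auto
  consider "z = p" | "z = p + 1" | "z = p + int m + 1" "m \<noteq> 0" | "z = p + int m + 2"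
    | "p + 2 \<le> z" "z \<le> p + int m" | "p + int m + 3 \<le> z"
    using z by force
  then show ?thesis
  proof cases
    case 1
    then have sh: "change_at p m s z = left_out m s" by (simp add: change_at_def)
    show ?thesis
    proof (cases s)
      case True
      show ?thesis
      \<comment> \<open>A 1 at \<open>p - 1\<close> gives the triple \<open>111\<close>: the left
        defect annihilates with a third one outside the segment.\<close>
      proof (cases "u (p - 1)")
        case True
        then have ?A unfolding sh unfolding 1
          using first snd \<open>s\<close> change_ge[OF mn] by (intro conjI defects_annihilate[OF u]) auto
        then show ?thesis ..
      next
        case False
        have act: "rule67 b (u (z - 1)) (u z) (u (z + 1)) \<noteq> u z"
          using first snd \<open>s\<close> 1 by (simp add: rule67_def)
        have "segment (step z u) (p - 1) (m + 1) False"
          unfolding segment_def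
        proof (intro conjI allI impI)
          show "step z u (p - 1) = False" using flip[OF _ act, of "p - 1"] 1 False n_ge by simp
          show "step z u (p - 1 + 1 + int j) = (False \<noteq> odd j)" if "j \<le> m + 1" for j
          proof (cases j)
            case 0
            then show ?thesis using flip[OF _ act, of p] 1 first \<open>s\<close> n_ge by simp
          next
            case (Suc i)
            then show ?thesis
              using flip[OF _ act, of "p + int j"] 1 alt[of i] that mn \<open>s\<close> by (simp add: algebra_simps)
          qed
          show "step z u (p - 1 + int (m + 1) + 2) = (False \<noteq> odd (m + 1))"
            using flip[OF _ act, of "p + int m + 2"] 1 last mn \<open>s\<close> by (simp add: algebra_simps)
        qed (use mn in simp)
        moreover have "pot_same (m + 1) False = pot_same m s + change_at p m s z"
          unfolding sh left_out_def using \<open>s\<close> by simp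
        ultimately have ?B by (metis order_refl)
        then show ?thesis ..
      qed
    next
      case False
      then have sh0: "change_at p m s z = 0" unfolding sh left_out_def by simp
      show ?thesis
      proof (cases "b \<and> \<not> u (p - 1)")
        case True
        then have ?A unfolding sh0 unfolding 1
          using first snd False by (intro conjI defects_annihilate[OF u]) auto
        then show ?thesis ..
      next
        case False
        then have "step z u = u"
          using 1 \<open>\<not> s\<close> first snd by (intro step_id[OF u]) (auto simp: rule67_def)
        then show ?thesis using stay sh0 by simp
      qed
    qed
  next
    case 2
    show ?thesis
    proof (cases "m = 0")
      case True
      then have sh: "change_at p m s z = left_in m s"
        using 2 by (simp add: change_at_def right_in_def)
      have third: "u (p + 2) = s" using last True by simp
      show ?thesis
      proof (cases "b \<or> s")
        case True
        then have ?A unfolding sh unfolding 2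
          using first snd third change_ge[OF mn]
          by (intro conjI defects_annihilate[OF u]) (auto simp: algebra_simps)
        then show ?thesis ..
      next
        case False
        then have "step z u = u" using 2 first snd third
          by (intro step_id[OF u]) (auto simp: rule67_def algebra_simps)
        moreover have "0 \<le> change_at p m s z" unfolding sh left_in_def using True False by simp
        ultimately show ?thesis using stay by blast
      qed
    next
      case False
      then have sh: "change_at p m s z = left_in m s" using 2 by (simp add: change_at_def)
      have third: "u (p + 2) = (\<not> s)" using alt[of 1] False by (simp add: algebra_simps)
      have act: "rule67 b (u (z - 1)) (u z) (u (z + 1)) \<noteq> u z"
        using first snd third 2 by (auto simp: rule67_def algebra_simps)
      have "segment (step z u) (p + 1) (m - 1) (\<not> s)"
        unfolding segment_def
      proof (intro conjI allI impI)
        show "step z u (p + 1) = (\<not> s)" using flip[OF _ act, of "p + 1"] 2 snd n_ge by simp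
        show "step z u (p + 1 + 1 + int j) = ((\<not> s) \<noteq> odd j)" if "j \<le> m - 1" for j
          using flip[OF _ act, of "p + 2 + int j"] alt[of "Suc j"] 2 that False mn
          by (simp add: algebra_simps)
        show "step z u (p + 1 + int (m - 1) + 2) = ((\<not> s) \<noteq> odd (m - 1))"
          using flip[OF _ act, of "p + int m + 2"] last 2 False mn
          by (cases m) (simp_all add: algebra_simps)
      qed (use mn in simp)
      moreover have "pot_same (m - 1) (\<not> s) = pot_same m s + change_at p m s z"
        using False by (simp add: sh left_in_def)
      ultimately have ?B by (metis order_refl)
      then show ?thesis ..
    qed
  next
    case 3
    then have sh: "change_at p m s z = right_in m s" by (simp add: change_at_def)
    obtain k where k: "m = Suc k" using 3 by (cases m) auto
    have prev: "u (p + int m) = (s = odd m)" using alt[of k] k by (simp add: algebra_simps)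
    show ?thesis
    proof (cases "s \<noteq> odd m")
      case True
      have act: "rule67 b (u (z - 1)) (u z) (u (z + 1)) \<noteq> u z"
        using prev pen last True 3 by (simp add: rule67_def algebra_simps)
      have "segment (step z u) p (m - 1) s"
        unfolding segment_def
      proof (intro conjI allI impI)
        show "step z u p = s" using flip[OF _ act, of p] 3 first mn by simp
        show "step z u (p + 1 + int j) = (s \<noteq> odd j)" if "j \<le> m - 1" for j
          using flip[OF _ act, of "p + 1 + int j"] alt[of j] 3 that mn k by simp
        show "step z u (p + int (m - 1) + 2) = (s \<noteq> odd (m - 1))"
          using flip[OF _ act, of z] 3 pen n_ge k by (simp add: algebra_simps)
      qed (use mn in simp)
      moreover have "pot_same (m - 1) s = pot_same m s + change_at p m s z"
        unfolding sh right_in_def using True 3 by simp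
      ultimately have ?B by (metis order_refl)
      then show ?thesis ..
    next
      case False
      then have "step z u = u" using 3 prev pen last
        by (intro step_id[OF u]) (auto simp: rule67_def algebra_simps)
      moreover have "0 \<le> change_at p m s z" unfolding sh right_in_def using False by simp
      ultimately show ?thesis using stay by blast
    qed
  next
    case 4
    then have sh: "change_at p m s z = right_out m s" by (simp add: change_at_def)
    have prev: "u (z - 1) = (s \<noteq> odd m)" using 4 pen by (simp add: algebra_simps)
    have self: "u z = (s \<noteq> odd m)" using 4 last by simp
    \<comment> \<open>The right defect annihilates with a third one to its right, is blocked inside
      \<open>000\<close> for code 6, or moves.\<close>
    consider (annihilate) "u (z + 1) = (s \<noteq> odd m)" "b \<or> s \<noteq> odd m"
      | (blocked) "\<not> u (z + 1)" "\<not> b" "s = odd m"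
      | (free) "u (z + 1) \<noteq> (s \<noteq> odd m)" by blast
    then show ?thesis
    proof cases
      case annihilate
      then have ?A unfolding sh using prev self change_ge[OF mn]
        by (intro conjI defects_annihilate[OF u]) auto
      then show ?thesis ..
    next
      case blocked
      then have "step z u = u" using prev self by (intro step_id[OF u]) (simp add: rule67_def)
      \<comment> \<open>For \<open>m = 0\<close> the cell \<open>z + 1\<close> is
        \<open>p + 3\<close>, which \<open>unblocked\<close> makes a 1.\<close>
      moreover have "m \<noteq> 0"
      proof
        assume m: "m = 0"
        then have "\<not> s" "z + 1 = p + 3" using blocked 4 by simp_all
        then show False using unblocked m blocked by metis
      qed
      ultimately show ?thesis using stay right_out_nonneg[OF mn] blocked sh by simp
    next
      case free
      have act: "rule67 b (u (z - 1)) (u z) (u (z + 1)) \<noteq> u z"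
        using prev self free by (auto simp: rule67_def)
      have "segment (step z u) p (m + 1) s"
        unfolding segment_def
      proof (intro conjI allI impI)
        show "step z u p = s" using flip[OF _ act, of p] 4 first mn by simp
        show "step z u (p + 1 + int j) = (s \<noteq> odd j)" if "j \<le> m + 1" for j
        proof (cases "j = m + 1")
          case True
          then have "p + 1 + int j = z" using 4 by simp
          then show ?thesis using flip[OF _ act, of z] self True n_ge by simp
        next
          case False
          then show ?thesis using flip[OF _ act, of "p + 1 + int j"] alt[of j] 4 that mn by simp
        qed
        have e: "p + int (m + 1) + 2 = z + 1" using 4 by simp
        show "step z u (p + int (m + 1) + 2) = (s \<noteq> odd (m + 1))"
          unfolding e using flip[OF _ act, of "z + 1"] free n_ge by simp
      qed (use mn in simp)
      moreover have "pot_same (m + 1) s = pot_same m s + change_at p m s z"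
        by (simp add: sh right_out_def)
      ultimately have ?B by (metis order_refl)
      then show ?thesis ..
    qed
  next
    case 5
    then have sh: "change_at p m s z = 0" by (simp add: change_at_def)
    define j where "j = nat (z - p - 1)"
    have j: "z = p + 1 + int j" "1 \<le> j" "j + 1 \<le> m" using 5 by (auto simp: j_def)
    have "u z = (s \<noteq> odd j)" "u (z - 1) = (s = odd j)" "u (z + 1) = (s = odd j)"
      using alt[of j] alt[of "j - 1"] alt[of "j + 1"] j by (auto simp: of_nat_diff algebra_simps)
    then have "step z u = u" by (intro step_id[OF u]) (auto simp: rule67_def)
    then show ?thesis using stay sh by simp
  next
    case 6
    then have sh: "change_at p m s z = 0" by (simp add: change_at_def)
    have same: "step z u x = u x" if "p \<le> x" "x \<le> p + int m + 2" for x
      using step_near[of x z u] that 6 z by auto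
    have "segment (step z u) p m s"
      using seg same unfolding segment_def by simp
    then show ?thesis using sh by auto
  qed
qed

section \<open>Two configurations with one defect each\<close>

text \<open>
  One step may lead from \<open>q < q' \<le> q + n\<close> slightly out of this range; then the roles of the two
  defects are exchanged.
\<close>

definition pot_pair :: "int \<Rightarrow> int \<Rightarrow> int" where
  "pot_pair q q' = (if q' = q then 0
     else if q' = q - 1 then pot_cross 1 (odd q')
     else if q' = q + int n + 1 then pot_cross (n - 1) (odd q')
     else pot_cross (nat (q' - q)) (odd q))"

lemma pot_pair_add: "0 < d \<Longrightarrow> d \<le> n \<Longrightarrow> pot_pair q (q + int d) = pot_cross d (odd q)"
  by (simp add: pot_pair_def)

lemma pot_pair_diff:
  assumes "0 < q' - q" "q' - q \<le> int n"
  shows "pot_pair q q' = pot_cross (nat (q' - q)) (odd q)"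
  using assms by (simp add: pot_pair_def)

lemma move_near:
  assumes "\<bar>z - (q + 1)\<bar> < int n" "\<bar>z - q\<bar> < int n"
  shows "move z q = (if z = q + 1 then q + 1 else if z = q \<and> odd q then q - 1 else q)"
  using dvd_small[OF _ assms(1)] dvd_small[OF _ assms(2)] n_ge unfolding move_def by auto

text \<open>For \<open>2 \<le> d\<close> and \<open>d + 2 \<le> n\<close> the four active cells are
  distinct on the ring and, apart from the special values at distance 1, the computation is that of
  \<open>pot_same_drift\<close>. In the other cases one update may act on both defects.\<close>

lemma pot_pair_drift:
  assumes "0 < d" "d \<le> n"
  shows "(\<Sum>z\<in>{q..<q + int n}. pot_pair (move z q) (move z (q + int d)) - pot_cross d (odd q)) \<le> - 1"
    (is "sum ?f _ \<le> _")
proof -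
  have mq: "move z q = (if z = q + 1 then q + 1 else if z = q \<and> odd q then q - 1 else q)"
    if "z \<in> {q..<q + int n}" for z
    using that n_ge by (intro move_near) auto
  have base: "pot_pair q (q + int d) = pot_cross d (odd q)" by (rule pot_pair_add[OF assms])
  have restrict: "sum ?f {q..<q + int n} = sum ?f T"
    if "T \<subseteq> {q..<q + int n}"
      and "\<And>z. z \<in> {q..<q + int n} \<Longrightarrow> z \<notin> T \<Longrightarrow> move z q = q \<and> move z (q + int d) = q + int d" for T
    using that base by (intro sum.mono_neutral_right) auto
  consider "d = 1" | "2 \<le> d" "d + 2 \<le> n" | "d + 1 = n" "d \<noteq> 1" | "d = n"
    using assms n_ge by linarith
  then show ?thesis
  proof cases
    case 1
    have mq': "move z (q + 1) = (if z = q + 2 then q + 2 else if z = q + 1 \<and> even q then q else q + 1)"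
      if "z \<in> {q..<q + int n}" for z
      using that n_ge by (subst move_near) auto
    have "sum ?f {q..<q + int n} = sum ?f {q, q + 1, q + 2}"
      using 1 n_ge mq mq' by (intro restrict) auto
    also have "\<dots> = ?f q + ?f (q + 1) + ?f (q + 2)" by simp
    also have "\<dots> \<le> - 1"
      using n_ge mq[of q] mq[of "q + 1"] mq[of "q + 2"] mq'[of q] mq'[of "q + 1"] mq'[of "q + 2"] 1
      by (cases "odd q") (simp_all add: pot_pair_def pot_def profile_def gap_def)
    finally show ?thesis .
  next
    case 2
    have mq': "move z (q + int d) = (if z = q + int d + 1 then q + int d + 1
        else if z = q + int d \<and> odd (q + int d) then q + int d - 1 else q + int d)"
      if "z \<in> {q..<q + int n}" for z
      using that 2 by (subst move_near) auto
    have "sum ?f {q..<q + int n} = sum ?f {q, q + 1, q + int d, q + int d + 1}"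
      using 2 mq mq' by (intro restrict) auto
    also have "\<dots> = ?f q + ?f (q + 1) + ?f (q + int d) + ?f (q + int d + 1)" using 2 by simp
    also have "\<dots> = (if odd q then pot_cross (d + 1) False - pot_cross d True else 0)
        + (pot_cross (d - 1) (even q) - pot_cross d (odd q))
        + (if odd (q + int d) then pot_cross (d - 1) (odd q) - pot_cross d (odd q) else 0)
        + (pot_cross (d + 1) (odd q) - pot_cross d (odd q))"
    proof -
      have "pot_pair (q - 1) (q + int d) = pot_cross (d + 1) (even q)"
        using pot_pair_add[of "d + 1" "q - 1"] 2 by simp
      moreover have "pot_pair (q + 1) (q + int d) = pot_cross (d - 1) (even q)"
        using pot_pair_add[of "d - 1" "q + 1"] 2 by (simp add: of_nat_diff)
      moreover have "pot_pair q (q + int d - 1) = pot_cross (d - 1) (odd q)"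
        using pot_pair_add[of "d - 1" q] 2 by (simp add: of_nat_diff algebra_simps)
      moreover have "pot_pair q (q + int d + 1) = pot_cross (d + 1) (odd q)"
        using pot_pair_add[of "d + 1" q] 2 by (simp add: algebra_simps)
      ultimately show ?thesis
        using base 2 mq[of q] mq[of "q + 1"] mq[of "q + int d"] mq[of "q + int d + 1"]
          mq'[of q] mq'[of "q + 1"] mq'[of "q + int d"] mq'[of "q + int d + 1"] by simp
    qed
    also have "\<dots> \<le> - 1"
    proof (cases "d = 2")
      case True
      then show ?thesis using n_ge
        by (cases "odd q") (simp_all add: pot_def profile_def gap_def)
    next
      case False
      then obtain k where k: "d = Suc (Suc (Suc k))" using 2
        by (metis One_nat_def Suc_1 Suc_le_D not_less_eq_eq not0_implies_Suc)
      show ?thesis unfolding k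
        by (cases "odd q"; cases "odd k") (simp_all add: pot_def profile_def gap_def algebra_simps)
    qed
    finally show ?thesis .
  next
    case 3
    then have d: "int d = int n - 1" by linarith
    have odd': "odd (q + int d) = odd q" using d n_odd by simp
    \<comment> \<open>Modulo \<open>n\<close>, the cell \<open>q\<close> is also the right cell
      \<open>q + d + 1\<close> of the right defect.\<close>
    have at_q: "move q (q + int d) = q + int d + 1"
      using d by (simp add: move_def)
    have mq': "move z (q + int d) = (if z = q + int d \<and> odd q then q + int d - 1 else q + int d)"
      if "z \<in> {q..<q + int n}" "z \<noteq> q" for z
      using that d odd' by (subst move_near) auto
    have "sum ?f {q..<q + int n} = sum ?f {q, q + 1, q + int d}"
      using 3 d n_ge mq mq' by (intro restrict) auto
    also have "\<dots> = ?f q + ?f (q + 1) + ?f (q + int d)" using 3 d n_ge by simp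
    also have "\<dots> = (if odd q then 0 else pot_cross n False - pot_cross d False)
        + (pot_cross (d - 1) (even q) - pot_cross d (odd q))
        + (if odd q then pot_cross (d - 1) (odd q) - pot_cross d (odd q) else 0)"
    proof -
      \<comment> \<open>The defects move apart to distance \<open>n + 1\<close>, which is
        \<open>n - 1 = d\<close> the other way round. As \<open>d\<close> is even,
        \<open>gap\<close> does not depend on the type.\<close>
      have "odd q \<Longrightarrow> pot_pair (q - 1) (q + int d + 1) = pot_cross d True"
        using d 3 n_odd n_ge by (simp add: pot_pair_def) (auto simp: pot_def gap_def)
      moreover have "pot_pair q (q + int d + 1) = pot_cross n (odd q)"
      proof -
        have e: "q + int d + 1 = q + int n" using d by simp
        show ?thesis unfolding e using pot_pair_add[of n q] n_ge by simp
      qed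
      moreover have "pot_pair (q + 1) (q + int d) = pot_cross (d - 1) (even q)"
        using pot_pair_add[of "d - 1" "q + 1"] 3 n_ge by (simp add: of_nat_diff)
      moreover have "pot_pair q (q + int d - 1) = pot_cross (d - 1) (odd q)"
        using pot_pair_add[of "d - 1" q] 3 n_ge by (simp add: of_nat_diff algebra_simps)
      ultimately show ?thesis
        using base 3 d n_ge at_q mq[of q] mq[of "q + 1"] mq[of "q + int d"]
          mq'[of "q + 1"] mq'[of "q + int d"] by simp
    qed
    also have "\<dots> \<le> - 1"
    proof (cases "n = 3")
      case True
      then have "d = 2" using 3 by simp
      then show ?thesis
        unfolding pot_def profile_def gap_def using True by (cases "odd q") simp_all
    next
      case False
      then have "\<exists>k. d = Suc (Suc (Suc k))" using 3 n_ge n_odd by presburger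
      then obtain k where k: "d = Suc (Suc (Suc k))" by blast
      then have nk: "n = k + 4" "odd k" using 3 n_odd by auto
      show ?thesis unfolding k pot_def profile_def gap_def using nk(2)
        by (cases "odd q") (simp_all add: nk(1) algebra_simps)
    qed
    finally show ?thesis .
  next
    \<comment> \<open>The defects share their place on the ring but have opposite types. Updating
      \<open>q\<close> moves only the one of type \<open>11\<close>, to distance
      \<open>n - 1\<close> up to exchange of roles; updating \<open>q + 1\<close> moves both and
      keeps the distance.\<close>
    case 4
    have "n - Suc 0 \<noteq> Suc 0" using n_ge by simp
    have mq': "move z (q + int n) = (if z = q + 1 then q + int n + 1
        else if z = q \<and> even q then q + int n - 1 else q + int n)"
      if "z \<in> {q..<q + int n}" for z
    proof -
      have "int n dvd z - (q + int n + 1) \<longleftrightarrow> int n dvd z - (q + 1)"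
        using dvd_add_triv_right_iff[of "int n" "z - (q + int n + 1)"] by (simp add: algebra_simps)
      moreover have "int n dvd z - (q + int n) \<longleftrightarrow> int n dvd z - q"
        using dvd_add_triv_right_iff[of "int n" "z - (q + int n)"] by (simp add: algebra_simps)
      ultimately show ?thesis
        using dvd_small[of "z - (q + 1)"] dvd_small[of "z - q"] that n_ge n_odd
        by (auto simp: move_def)
    qed
    have "sum ?f {q..<q + int n} = sum ?f {q, q + 1}"
      using 4 n_ge mq mq' by (intro restrict) auto
    also have "\<dots> = ?f q + ?f (q + 1)" by simp
    also have "\<dots> = (pot_cross (n - 1) False - pot_cross n (odd q)) + (pot_cross n (even q) - pot_cross n (odd q))"
    proof -
      have "odd q \<Longrightarrow> pot_pair (q - 1) (q + int n) = pot_cross (n - 1) False"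
        using n_odd n_ge by (simp add: pot_pair_def)
      moreover have "even q \<Longrightarrow> pot_pair q (q + int n - 1) = pot_cross (n - 1) False"
        using pot_pair_add[of "n - 1" q] n_ge by (simp add: of_nat_diff algebra_simps)
      moreover have "pot_pair (q + 1) (q + int n + 1) = pot_cross n (even q)"
        using pot_pair_add[of n "q + 1"] n_ge by (simp add: algebra_simps)
      ultimately show ?thesis
        using 4 n_ge mq[of q] mq[of "q + 1"] mq'[of q] mq'[of "q + 1"] by simp
    qed
    also have "\<dots> \<le> - 1"
      using n_ge n_odd \<open>n - Suc 0 \<noteq> Suc 0\<close>
      by (cases "odd q") (simp_all add: pot_def profile_def gap_def of_nat_diff algebra_simps)
    finally show ?thesis .
  qed
qed

section \<open>The Lyapunov function\<close>

text \<open>With a minimum, any pair present after an update gives an upper bound, so it is enough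
  to follow one minimal pair.\<close>

definition segment_weight :: "(int \<Rightarrow> bool) \<Rightarrow> nat" where
  "segment_weight u = (LEAST v. \<exists>p m s. segment u p m s \<and> v = nat (pot_same m s))"

definition window_weight :: "(int \<Rightarrow> bool) \<Rightarrow> (int \<Rightarrow> bool) \<Rightarrow> nat" where
  "window_weight u u' = (LEAST v. \<exists>q d. 0 < d \<and> d \<le> n \<and> v = nat (pot_cross d (odd q)) \<and>
     (window u q \<and> window u' (q + int d) \<or> window u' q \<and> window u (q + int d)))"

lemma segment_pot_same: "segment u p m s \<Longrightarrow> 0 \<le> pot_same m s \<and> pot_same m s \<le> int max_pot"
  using pot_same_bounds[of m s] by (simp add: segment_def)

lemma segment_weight_le:
  assumes "segment u p m s"
  shows "int (segment_weight u) \<le> pot_same m s"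
proof -
  have "segment_weight u \<le> nat (pot_same m s)" unfolding segment_weight_def using assms by (intro Least_le) blast
  then show ?thesis using segment_pot_same[OF assms] by linarith
qed

text \<open>All adjacent pairs in a run of zeros have the same potential, so the minimal pair can be
  chosen to satisfy the condition \<open>unblocked\<close> of \<open>segment_step\<close>.\<close>

lemma segment_weight_attained:
  assumes "valid u" "3 \<le> defects u"
  obtains p m s where "segment u p m s" "int (segment_weight u) = pot_same m s"
    "m = 0 \<and> \<not> s \<longrightarrow> b \<or> u (p + 3)"
proof -
  have "\<exists>v p m s. segment u p m s \<and> v = nat (pot_same m s)" using segment_ex[OF assms(2)] by blast
  then have "\<exists>p m s. segment u p m s \<and> segment_weight u = nat (pot_same m s)"
    unfolding segment_weight_def by (rule LeastI_ex)
  then obtain p m s where seg: "segment u p m s" and w: "int (segment_weight u) = pot_same m s"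
    using segment_pot_same by (metis int_nat_eq)
  show thesis
  proof (cases "m = 0 \<and> \<not> s \<and> \<not> b")
    case False
    then show ?thesis using that seg w by blast
  next
    case True
    \<comment> \<open>The pair is inside a run of zeros: move to the end of the run.\<close>
    have u: "periodic u" using assms(1) by (simp add: valid_def)
    obtain x where x: "u x" using assms(1) True unfolding valid_def by blast
    define P where "P k \<longleftrightarrow> u (p + 3 + int k)" for k
    have "P (nat ((x - (p + 3)) mod int n))"
    proof -
      have "int n dvd (p + 3 + (x - (p + 3)) mod int n) - x"
        using mod_eq_dvd_iff[of "p + 3 + (x - (p + 3)) mod int n" "int n" x]
        by (simp add: mod_add_right_eq)
      from periodic_cong[OF u this] show ?thesis using x n_ge by (simp add: P_def)
    qed
    then have PL: "P (LEAST k. P k)" by (rule LeastI)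
    define k where "k = (LEAST k. P k)"
    have less: "\<not> u (p + 3 + int i)" if "i < k" for i
      using not_less_Least[of i P] that by (simp add: k_def P_def)
    have zeros: "\<not> u p" "\<not> u (p + 1)" "\<not> u (p + 2)" using seg True by (auto simp: segment_def)
    have zero: "\<not> u (p + int i)" if "i < k + 3" for i
    proof -
      consider "i = 0" | "i = 1" | "i = 2" | j where "i = j + 3"
        by (metis One_nat_def Suc_1 Suc_eq_plus1 add.commute add_Suc_right numeral_3_eq_3 old.nat.exhaust)
      then show ?thesis
      proof cases
        case 4
        then show ?thesis using less[of j] that by (simp add: algebra_simps)
      qed (use zeros in auto)
    qed
    have "segment u (p + int k) 0 False"
      using zero[of k] zero[of "k + 1"] zero[of "k + 2"] n_ge
      by (simp add: segment_def algebra_simps)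
    moreover have "u (p + int k + 3)" using PL by (simp add: P_def k_def algebra_simps)
    ultimately show ?thesis using that[of "p + int k" 0 False] w True by simp
  qed
qed

lemma window_weight_commute: "window_weight u u' = window_weight u' u"
  unfolding window_weight_def by (simp only: disj_commute)

lemma window_weight_le:
  assumes "0 < d" "d \<le> n"
    "window u q \<and> window u' (q + int d) \<or> window u' q \<and> window u (q + int d)"
  shows "int (window_weight u u') \<le> pot_cross d (odd q)"
proof -
  have "window_weight u u' \<le> nat (pot_cross d (odd q))"
    unfolding window_weight_def using assms by (intro Least_le) blast
  then show ?thesis using pot_cross_bounds(1)[OF assms(2), of "odd q"] by linarith
qed

lemma window_weight_le_pot_pair:
  assumes u: "periodic u" "periodic u'" and w: "window u q" "window u' q'" and ne: "u \<noteq> u'"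
    and q: "q - 1 \<le> q'" "q' \<le> q + int n + 1"
  shows "int (window_weight u u') \<le> pot_pair q q'"
proof -
  have "q' \<noteq> q" using window_unique[OF u] w ne by blast
  then consider "q' = q - 1" | "q' = q + int n + 1" | "0 < q' - q" "q' - q \<le> int n"
    using q by linarith
  then show ?thesis
  proof cases
    case 1
    then show ?thesis using window_weight_le[of 1 u q' u'] w n_ge by (simp add: pot_pair_def)
  next
    case 2
    \<comment> \<open>The same defect, one turn of the double cover further, lies
      \<open>n - 1\<close> to the right of \<open>q'\<close>.\<close>
    have "window u (q + 2 * int n * 1)" by (rule window_shift[OF u(1) w(1)])
    moreover have "q' + int (n - 1) = q + 2 * int n * 1" using 2 n_ge by (simp add: of_nat_diff)
    ultimately have "window u (q' + int (n - 1))" by simp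
    then show ?thesis using window_weight_le[of "n - 1" u q' u'] w n_ge 2 by (simp add: pot_pair_def)
  next
    case 3
    then show ?thesis using window_weight_le[of "nat (q' - q)" u q u'] w by (simp add: pot_pair_diff)
  qed
qed

text \<open>On the cycle of length \<open>2 * n\<close> one of the two defects reaches the other by
  at most \<open>n\<close> steps to the right.\<close>

lemma window_weight_attained:
  assumes u: "periodic u" "periodic u'" and d: "defects u < 3" "defects u' < 3" and ne: "u \<noteq> u'"
  obtains q d where "0 < d" "d \<le> n" "int (window_weight u u') = pot_cross d (odd q)"
    "window u q \<and> window u' (q + int d) \<or> window u' q \<and> window u (q + int d)"
proof -
  obtain q where q: "window u q" using window_ex[OF u(1) d(1)] by blast
  obtain q0 where q0: "window u' q0" using window_ex[OF u(2) d(2)] by blast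
  define e where "e = (q0 - q) mod (2 * int n)"
  define q' where "q' = q + e"
  have e: "0 \<le> e" "e < 2 * int n" using n_ge by (simp_all add: e_def)
  have "q' = q0 + 2 * int n * (- ((q0 - q) div (2 * int n)))"
    using div_mult_mod_eq[of "q0 - q" "2 * int n"] by (simp add: q'_def e_def algebra_simps)
  then have q': "window u' q'" using window_shift[OF u(2) q0] by metis
  have "e \<noteq> 0" using window_unique[OF u q] q' ne by (auto simp: q'_def)
  have "\<exists>q d. 0 < d \<and> d \<le> n \<and>
     (window u q \<and> window u' (q + int d) \<or> window u' q \<and> window u (q + int d))"
  proof (cases "e \<le> int n")
    case True
    then show ?thesis using e \<open>e \<noteq> 0\<close> q q'
      by (intro exI[of _ q] exI[of _ "nat e"]) (simp add: q'_def)
  next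
    case False
    have "window u (q + 2 * int n * 1)" by (rule window_shift[OF u(1) q])
    then have "window u (q' + int (nat (2 * int n - e)))" using e by (simp add: q'_def)
    then show ?thesis using e False q' by (intro exI[of _ q'] exI[of _ "nat (2 * int n - e)"]) auto
  qed
  then have "\<exists>v q d. 0 < d \<and> d \<le> n \<and> v = nat (pot_cross d (odd q)) \<and>
     (window u q \<and> window u' (q + int d) \<or> window u' q \<and> window u (q + int d))" by blast
  then have "\<exists>q d. 0 < d \<and> d \<le> n \<and> window_weight u u' = nat (pot_cross d (odd q)) \<and>
     (window u q \<and> window u' (q + int d) \<or> window u' q \<and> window u (q + int d))"
    unfolding window_weight_def by (rule LeastI_ex)
  then show thesis using that pot_cross_bounds(1) by (metis int_nat_eq)
qed

text \<open>The case can change only through an annihilation, and then the defect term of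
  \<open>lyapunov\<close> outweighs any change of the weight.\<close>

definition weight :: "(int \<Rightarrow> bool) \<Rightarrow> (int \<Rightarrow> bool) \<Rightarrow> nat" where
  "weight u u' = (if 3 \<le> defects u then segment_weight u
     else if 3 \<le> defects u' then segment_weight u' else window_weight u u')"

definition lyapunov :: "(int \<Rightarrow> bool) \<Rightarrow> (int \<Rightarrow> bool) \<Rightarrow> nat" where
  "lyapunov u u' = (if u = u' then 0
     else max_pot * (defects u + defects u') + weight u u')"

lemma weight_le:
  assumes "valid u" "valid u'" "u \<noteq> u'"
  shows "weight u u' \<le> max_pot"
proof -
  have one: "segment_weight w \<le> max_pot" if w: "valid w" "3 \<le> defects w" for w
  proof -
    obtain p m s where "segment w p m s" "int (segment_weight w) = pot_same m s"
      "m = 0 \<and> \<not> s \<longrightarrow> b \<or> w (p + 3)"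
      by (rule segment_weight_attained[OF w])
    then show ?thesis using segment_pot_same[of w p m s] by linarith
  qed
  have per: "periodic u" "periodic u'" using assms(1,2) by (simp_all add: valid_def)
  have "window_weight u u' \<le> max_pot" if few: "defects u < 3" "defects u' < 3"
  proof -
    obtain q d where "0 < d" "d \<le> n" "int (window_weight u u') = pot_cross d (odd q)"
      "window u q \<and> window u' (q + int d) \<or> window u' q \<and> window u (q + int d)"
      by (rule window_weight_attained[OF per few assms(3)])
    then show ?thesis using pot_cross_bounds(2)[of d "odd q"] by linarith
  qed
  then show ?thesis using one assms by (auto simp: weight_def)
qed

lemma lyapunov_le:
  assumes "valid u" "valid u'"
  shows "lyapunov u u' \<le> max_pot * (2 * n + 1)"
proof -
  have "defects w \<le> n" for w
    unfolding defects_def by (rule order_trans[OF sum_bounded_above[of _ _ 1]]) auto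
  from add_mono[OF this this] have d: "max_pot * (defects u + defects u') \<le> max_pot * (n + n)"
    by (rule mult_le_mono2)
  have e: "max_pot * (2 * n + 1) = max_pot * (n + n) + max_pot"
    by (simp add: algebra_simps)
  show ?thesis
  proof (cases "u = u'")
    case False
    from add_mono[OF d weight_le[OF assms this]] show ?thesis
      unfolding e lyapunov_def using False by (simp only: if_False)
  qed (simp add: lyapunov_def)
qed

text \<open>Two lost defects release \<open>2 * max_pot\<close>; the new weight takes back at most
  \<open>max_pot\<close>.\<close>

lemma lyapunov_annihilate:
  assumes v: "valid u" "valid u'" and ne: "u \<noteq> u'"
    and a: "defects (step z u) + defects (step z u') + 2 \<le> defects u + defects u'"
  shows "int (lyapunov (step z u) (step z u')) \<le> int (lyapunov u u') - int max_pot"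
proof -
  let ?k = "defects u + defects u'" and ?k' = "defects (step z u) + defects (step z u')"
  have "lyapunov (step z u) (step z u') \<le> max_pot * ?k' + max_pot"
    using weight_le[OF valid_step[OF v(1)] valid_step[OF v(2)], of z z] by (simp add: lyapunov_def)
  then have "lyapunov (step z u) (step z u') + max_pot \<le> max_pot * (?k' + 2)" by simp
  also have "\<dots> \<le> max_pot * ?k" using a by (intro mult_le_mono2) simp
  also have "\<dots> \<le> lyapunov u u'" using ne by (simp add: lyapunov_def)
  finally show ?thesis by linarith
qed

lemma lyapunov_weight:
  assumes v: "valid u" "valid u'" and ne: "u \<noteq> u'"
    and w: "step z u \<noteq> step z u' \<Longrightarrow> int (weight (step z u) (step z u')) \<le> int (weight u u') + f"
    and f: "- int max_pot \<le> f"
  shows "int (lyapunov (step z u) (step z u')) \<le> int (lyapunov u u') + f"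
proof (cases "step z u = step z u'")
  case True
  \<comment> \<open>\<open>lyapunov\<close> drops to 0 here. It was at least \<open>max_pot\<close>,
    because an odd number of defects is positive.\<close>
  have "periodic u" using v(1) by (simp add: valid_def)
  then have "odd (defects u)" by (rule odd_defects)
  then have "0 < defects u" by (rule odd_pos)
  then have "max_pot * 1 \<le> max_pot * (defects u + defects u')" by (intro mult_le_mono2) simp
  then have "max_pot \<le> max_pot * (defects u + defects u')" by (simp only: mult_1_right)
  then have "max_pot \<le> lyapunov u u'"
    unfolding lyapunov_def if_not_P[OF ne] by (rule trans_le_add1)
  then show ?thesis using True f by (simp add: lyapunov_def)
next
  case False
  have mono: "int (j' + w') \<le> int (j + w) + f" if "j' \<le> j" "int w' \<le> int w + f" for j j' w w'
    using that by linarith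
  have "defects (step z u) + defects (step z u') \<le> defects u + defects u'"
    using v by (intro add_mono defects_step_le) (simp_all add: valid_def)
  then have "max_pot * (defects (step z u) + defects (step z u'))
      \<le> max_pot * (defects u + defects u')"
    by (rule mult_le_mono2)
  then show ?thesis
    unfolding lyapunov_def if_not_P[OF ne] if_not_P[OF False] using w[OF False] by (rule mono)
qed

lemma lyapunov_drift_from:
  assumes f: "\<And>z. z \<in> {p..<p + int n} \<Longrightarrow>
      int (lyapunov (step z u) (step z u')) \<le> int (lyapunov u u') + f z"
    and "sum f {p..<p + int n} \<le> - 1"
  shows "(\<Sum>z\<in>{0..<int n}. lyapunov (step z u) (step z u')) + 1 \<le> n * lyapunov u u'"
proof -
  have "int (\<Sum>z\<in>{0..<int n}. lyapunov (step z u) (step z u'))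
      = (\<Sum>z\<in>{p..<p + int n}. int (lyapunov (step z u) (step z u')))"
    unfolding of_nat_sum by (rule sum_shift) (metis step_cong)
  also have "\<dots> \<le> (\<Sum>z\<in>{p..<p + int n}. int (lyapunov u u') + f z)" by (rule sum_mono[OF f])
  also have "\<dots> \<le> int (n * lyapunov u u') - 1" using assms(2) by (simp add: sum.distrib)
  finally show ?thesis by linarith
qed

lemma defects_step_cases:
  assumes "periodic u"
  shows "defects (step z u) = defects u \<or> defects (step z u) + 2 \<le> defects u"
proof -
  have "j = k \<or> j + 2 \<le> k" if "odd k" "odd j" "j \<le> k" for j k :: nat
    using that by presburger
  then show ?thesis
    using odd_defects[OF assms] odd_defects[OF periodic_step[OF assms]] defects_step_le[OF assms]
    by blast
qed

text \<open>A minimal pair is followed through one update. The pair it becomes bounds the new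
  minimum, so the drift of its potential carries over to \<open>lyapunov\<close>.\<close>

lemma lyapunov_drift:
  assumes v: "valid u" "valid u'" and ne: "u \<noteq> u'"
  shows "(\<Sum>z\<in>{0..<int n}. lyapunov (step z u) (step z u')) + 1 \<le> n * lyapunov u u'"
proof -
  have u: "periodic u" "periodic u'" using v by (auto simp: valid_def)
  have le: "defects (step z u) \<le> defects u" "defects (step z u') \<le> defects u'" for z
    using u by (simp_all add: defects_step_le)
  \<comment> \<open>\<open>w\<close> stands for the configuration that supplies the weight.\<close>
  have many: ?thesis
    if w: "valid w" "3 \<le> defects w" "weight u u' = segment_weight w"
      and weight: "\<And>z. 3 \<le> defects (step z w) \<Longrightarrow> weight (step z u) (step z u') = segment_weight (step z w)"
      and annih: "\<And>z. defects (step z w) + 2 \<le> defects w \<Longrightarrow>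
          defects (step z u) + defects (step z u') + 2 \<le> defects u + defects u'" for w
  proof -
    have wp: "periodic w" using w(1) by (simp add: valid_def)
    obtain p m s where seg: "segment w p m s" and min: "int (segment_weight w) = pot_same m s"
      and unblocked: "m = 0 \<and> \<not> s \<longrightarrow> b \<or> w (p + 3)"
      by (rule segment_weight_attained[OF w(1,2)])
    have mn: "m + 3 \<le> n" by (rule segment_length[OF wp seg])
    show ?thesis
    proof (rule lyapunov_drift_from[OF _ sum_change_at[OF mn]])
      fix z assume z: "z \<in> {p..<p + int n}"
      show "int (lyapunov (step z u) (step z u')) \<le> int (lyapunov u u') + change_at p m s z"
      proof (cases "defects (step z w) + 2 \<le> defects w \<and> - int max_pot \<le> change_at p m s z")
        case True
        then show ?thesis using lyapunov_annihilate[OF v ne annih] by fastforce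
      next
        case False
        then obtain p' m' s' where seg': "segment (step z w) p' m' s'"
          and pot: "pot_same m' s' \<le> pot_same m s + change_at p m s z"
          using segment_step[OF wp seg unblocked z] by blast
        have ge: "- int max_pot \<le> change_at p m s z"
          using pot segment_pot_same[OF seg'] segment_pot_same[OF seg] by linarith
        then have same: "defects (step z w) = defects w"
          using False defects_step_cases[OF wp, of z] by blast
        show ?thesis
        proof (rule lyapunov_weight[OF v ne _ ge])
          show "int (weight (step z u) (step z u')) \<le> int (weight u u') + change_at p m s z"
            using weight[of z] same w(2,3) segment_weight_le[OF seg'] pot min by simp
        qed
      qed
    qed
  qed
  \<comment> \<open>\<open>w\<close> and \<open>w'\<close> are \<open>u\<close> and
    \<open>u'\<close> in either order, since the left defect of the minimal pair may belong to
    either.\<close>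
  have few: ?thesis
    if d: "defects u < 3" "defects u' < 3" and w: "window w q" "window w' (q + int d)"
      and ww: "w = u \<and> w' = u' \<or> w = u' \<and> w' = u"
      and dn: "0 < d" "d \<le> n" and min: "int (window_weight u u') = pot_cross d (odd q)" for w w' q d
  proof (rule lyapunov_drift_from[OF _ pot_pair_drift[OF dn]])
    fix z
    have wp: "periodic w" "periodic w'" using ww u by auto
    define Q Q' where "Q = move z q" and "Q' = move z (q + int d)"
    have win: "window (step z w) Q" "window (step z w') Q'"
      unfolding Q_def Q'_def using window_step wp w by auto
    have bounds: "q - 1 \<le> Q" "Q \<le> q + 1" "q + int d - 1 \<le> Q'" "Q' \<le> q + int d + 1"
      by (auto simp: Q_def Q'_def move_def)
    have range: "Q - 1 \<le> Q'" "Q' \<le> Q + int n + 1"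
    proof -
      show "Q - 1 \<le> Q'" using bounds dn by linarith
      show "Q' \<le> Q + int n + 1"
      \<comment> \<open>The bound is in doubt only if the left defect moves left from distance
        \<open>n\<close>. The right one then does not move right, as \<open>q\<close> and
        \<open>q + n + 1\<close> are different cells of the ring.\<close>
      proof (cases "d = n \<and> Q = q - 1")
        case True
        then have "int n dvd z - q" by (auto simp: Q_def move_def split: if_splits)
        have "\<not> int n dvd z - (q + int d + 1)"
        proof
          assume "int n dvd z - (q + int d + 1)"
          from dvd_diff[OF \<open>int n dvd z - q\<close> this] have "int n dvd 1 + int n"
            using True by (simp add: algebra_simps)
          then have "int n dvd 1" by (simp only: dvd_add_triv_right_iff)
          then show False using n_ge by simp
        qed
        then have "Q' \<le> q + int d" by (simp add: Q'_def move_def)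
        then show ?thesis using True by simp
      qed (use bounds dn in linarith)
    qed
    have small: "defects (step z u) < 3" "defects (step z u') < 3"
      using le[of z] d by linarith+
    have nn: "0 \<le> pot_pair Q Q'"
      using range n_ge by (auto simp: pot_pair_def intro!: pot_cross_bounds(1))
    show "int (lyapunov (step z u) (step z u'))
        \<le> int (lyapunov u u') + (pot_pair Q Q' - pot_cross d (odd q))"
    proof (rule lyapunov_weight[OF v ne])
      assume "step z u \<noteq> step z u'"
      then have "step z w \<noteq> step z w'" using ww by auto
      from window_weight_le_pot_pair[OF periodic_step[OF wp(1)] periodic_step[OF wp(2)] win this range]
      have "int (window_weight (step z u) (step z u')) \<le> pot_pair Q Q'"
        using ww window_weight_commute by metis
      then show "int (weight (step z u) (step z u'))
          \<le> int (weight u u') + (pot_pair Q Q' - pot_cross d (odd q))"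
        using small d min by (simp add: weight_def)
    next
      show "- int max_pot \<le> pot_pair Q Q' - pot_cross d (odd q)"
        using nn pot_cross_bounds(2)[OF dn(2), of "odd q"] by linarith
    qed
  qed
  consider "3 \<le> defects u" | "defects u < 3" "3 \<le> defects u'" | "defects u < 3" "defects u' < 3"
    by linarith
  then show ?thesis
  proof cases
    case 1
    show ?thesis
    proof (rule many[OF v(1) 1])
      show "defects (step z u) + defects (step z u') + 2 \<le> defects u + defects u'"
        if "defects (step z u) + 2 \<le> defects u" for z using that le(2)[of z] by linarith
    qed (use 1 in \<open>simp_all add: weight_def\<close>)
  next
    case 2
    show ?thesis
    proof (rule many[OF v(2) 2(2)])
      show "defects (step z u) + defects (step z u') + 2 \<le> defects u + defects u'"
        if "defects (step z u') + 2 \<le> defects u'" for z using that le(1)[of z] by linarith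
      show "weight (step z u) (step z u') = segment_weight (step z u')" if "3 \<le> defects (step z u')" for z
        using le(1)[of z] 2 that by (simp add: weight_def)
    qed (use 2 in \<open>simp add: weight_def\<close>)
  next
    case 3
    obtain q d where "0 < d" "d \<le> n" "int (window_weight u u') = pot_cross d (odd q)"
      "window u q \<and> window u' (q + int d) \<or> window u' q \<and> window u (q + int d)"
      by (rule window_weight_attained[OF u 3 ne])
    then show ?thesis using few[OF 3] by blast
  qed
qed

section \<open>Coalescence\<close>

definition unroll :: "configuration \<Rightarrow> int \<Rightarrow> bool" where
  "unroll c x = c (nat (x mod int n))"

lemma periodic_unroll: "periodic (unroll c)"
  by (simp add: periodic_def unroll_def)

lemma unroll_eq_iff: "unroll c = unroll c' \<longleftrightarrow> same_config n c c'"
proof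
  assume eq: "unroll c = unroll c'"
  have "c z = c' z" if "z < n" for z
    using fun_cong[OF eq, of "int z"] that by (simp add: unroll_def)
  then show "same_config n c c'" by (simp add: same_config_def)
next
  assume "same_config n c c'"
  then have "c (nat (x mod int n)) = c' (nat (x mod int n))" for x
    using n_ge by (simp add: same_config_def nat_less_iff)
  then show "unroll c = unroll c'" by (simp add: unroll_def fun_eq_iff)
qed

text \<open>Transfers the lifted dynamic to the ring; \<open>z + n - 1\<close> and
  \<open>z - 1\<close> agree modulo \<open>n\<close>.\<close>

lemma unroll_update:
  assumes "z < n"
  shows "unroll (update_cell (rule67 b) n z c) = step (int z) (unroll c)"
proof
  fix x
  define y where "y = nat (x mod int n)"
  have y: "y < n" "int y = x mod int n" using n_ge by (simp_all add: y_def nat_less_iff)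
  have dvd: "int n dvd x - int z \<longleftrightarrow> y = z"
  proof -
    have "int n dvd x - int z \<longleftrightarrow> x mod int n = int z mod int n" by (simp add: mod_eq_dvd_iff)
    also have "\<dots> \<longleftrightarrow> int y = int z" using assms y by simp
    finally show ?thesis by simp
  qed
  show "unroll (update_cell (rule67 b) n z c) x = step (int z) (unroll c) x"
  proof (cases "y = z")
    case True
    have "int ((z + n - 1) mod n) = (int z + int n - 1) mod int n"
      using n_ge by (simp add: zmod_int of_nat_diff)
    also have "\<dots> = (int z - 1) mod int n" by (metis add.commute add_diff_eq mod_add_self1)
    finally have l: "nat ((int z - 1) mod int n) = (z + n - 1) mod n" by (metis nat_int)
    have "int ((z + 1) mod n) = (int z + 1) mod int n" by (simp add: zmod_int add.commute)
    then have r: "nat ((int z + 1) mod int n) = (z + 1) mod n" by (metis nat_int)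
    have "unroll c (x - 1) = unroll c (int z - 1)" "unroll c x = unroll c (int z)"
      "unroll c (x + 1) = unroll c (int z + 1)"
      using dvd True by (intro periodic_cong[OF periodic_unroll]; simp)+
    then have "step (int z) (unroll c) x
        = rule67 b (unroll c (int z - 1)) (unroll c (int z)) (unroll c (int z + 1))"
      using dvd True by (simp add: step_def)
    also have "\<dots> = rule67 b (c ((z + n - 1) mod n)) (c z) (c ((z + 1) mod n))"
      unfolding unroll_def l r using assms by simp
    also have "\<dots> = update_cell (rule67 b) n z c y" using True by (simp add: update_cell_def)
    finally show ?thesis by (simp add: unroll_def y_def)
  next
    case False
    then have "update_cell (rule67 b) n z c y = c y" by (simp add: update_cell_def)
    then show ?thesis using dvd False by (simp add: step_def unroll_def y_def)
  qed
qed

lemma valid_unroll: "b \<or> c \<in> nonzero_configs n \<Longrightarrow> valid (unroll c)"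
proof -
  assume c: "b \<or> c \<in> nonzero_configs n"
  have "\<exists>x. unroll c x" if "z < n" "c z" for z
    using that by (intro exI[of _ "int z"]) (simp add: unroll_def)
  then show ?thesis using c periodic_unroll by (auto simp: valid_def nonzero_configs_def)
qed

lemma expected_coalescence_time_le:
  assumes "b \<or> c \<in> nonzero_configs n" "b \<or> c' \<in> nonzero_configs n"
  shows "expected_coalescence_time (rule67 b) n c c' \<le> ennreal (6000 * real n ^ 4)"
proof -
  let ?V = "\<lambda>c c'. lyapunov (unroll c) (unroll c')"
  let ?I = "\<lambda>c c'. valid (unroll c) \<and> valid (unroll c')"
  have "expected_coalescence_time (rule67 b) n c c' \<le> of_nat (n * ?V c c')"
  proof (rule expected_coalescence_time_le_drift[where I = ?I])
    show "?I (update_cell (rule67 b) n z c) (update_cell (rule67 b) n z c')"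
      if "?I c c'" "z < n" for c c' z
      using that valid_step by (simp add: unroll_update)
    show "(\<Sum>z<n. ?V (update_cell (rule67 b) n z c) (update_cell (rule67 b) n z c'))
        + of_bool (\<not> same_config n c c') \<le> n * ?V c c'" if I: "?I c c'" for c c'
    proof -
      have "(\<Sum>z<n. ?V (update_cell (rule67 b) n z c) (update_cell (rule67 b) n z c'))
          = (\<Sum>z<n. lyapunov (step (int z) (unroll c)) (step (int z) (unroll c')))"
        by (intro sum.cong) (simp_all add: unroll_update)
      also have "\<dots> = (\<Sum>z\<in>{0..<int n}. lyapunov (step z (unroll c)) (step z (unroll c')))"
        by (rule sum.reindex_bij_witness[where i = nat and j = int]) auto
      finally have eq: "(\<Sum>z<n. ?V (update_cell (rule67 b) n z c) (update_cell (rule67 b) n z c'))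
          = (\<Sum>z\<in>{0..<int n}. lyapunov (step z (unroll c)) (step z (unroll c')))" .
      show ?thesis
      proof (cases "same_config n c c'")
        case True
        then have "unroll c = unroll c'" by (simp add: unroll_eq_iff)
        then show ?thesis unfolding eq using True by (simp add: lyapunov_def)
      next
        case False
        then show ?thesis unfolding eq using lyapunov_drift I unroll_eq_iff by simp
      qed
    qed
    show "?I c c'" using assms valid_unroll by blast
  qed (use n_ge in simp)
  \<comment> \<open>The constant is 2000 from \<open>max_pot\<close> times 3 from
    \<open>2 * n + 1 \<le> 3 * n\<close>.\<close>
  also have "n * ?V c c' \<le> 6000 * n ^ 4"
  proof -
    have "?V c c' \<le> max_pot * (2 * n + 1)"
      using assms by (intro lyapunov_le valid_unroll)
    also have "\<dots> \<le> max_pot * (3 * n)" using n_ge by (intro mult_le_mono2) simp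
    finally have "n * ?V c c' \<le> n * (max_pot * (3 * n))" by (rule mult_le_mono2)
    also have "\<dots> = 6000 * n ^ 4"
      by (simp add: max_pot_def power2_eq_square power4_eq_xxxx)
    finally show ?thesis .
  qed
  then have "(of_nat (n * ?V c c') :: ennreal) \<le> of_nat (6000 * n ^ 4)" by (simp only: of_nat_le_iff)
  also have "(of_nat (6000 * n ^ 4) :: ennreal) = ennreal (6000 * real n ^ 4)"
    by (simp only: ennreal_of_nat_eq_real_of_nat) simp
  finally show ?thesis .
qed

end

theorem mainTheorem3:
  fixes \<delta>6 \<delta>7 :: local_rule
  assumes "wolfram_code \<delta>6 = 6" and "wolfram_code \<delta>7 = 7"
  shows "coalescing \<delta>6 {n. odd n} nonzero_configs
       \<and> coalescing \<delta>7 {n. odd n \<and> n \<noteq> 1} (\<lambda>_. UNIV)"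
proof
  have \<delta>6: "\<delta>6 = rule67 False"
    using code6_iff[OF assms(1)] by (auto simp: fun_eq_iff rule67_def)
  have \<delta>7: "\<delta>7 = rule67 True"
    using code7_iff[OF assms(2)] by (auto simp: fun_eq_iff rule67_def)
  have big: "odd_ring n" if "odd n" "n \<noteq> 1" for n
    using that by unfold_locales presburger+
  show "coalescing \<delta>6 {n. odd n} nonzero_configs"
    unfolding coalescing_def
  proof (rule exI[of _ 6000], rule exI[of _ 4], intro ballI)
    fix n c c' assume n: "n \<in> {n. odd n}" and c: "c \<in> nonzero_configs n" "c' \<in> nonzero_configs n"
    show "expected_coalescence_time \<delta>6 n c c' \<le> ennreal (6000 * real n ^ 4)"
    proof (cases "n = 1")
      case True
      \<comment> \<open>A single cell has only one nonzero configuration, so the coalescence time is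
        0.\<close>
      then have "same_config n c c'" using c by (auto simp: same_config_def nonzero_configs_def)
      then have "coalescence_time \<delta>6 n c c' \<omega> \<le> of_nat 0" for \<omega>
        unfolding coalescence_time_def by (intro INF_lower) simp
      then show ?thesis by (simp add: expected_coalescence_time_def)
    next
      case False
      then show ?thesis
        unfolding \<delta>6 using n c by (intro odd_ring.expected_coalescence_time_le big) auto
    qed
  qed
  show "coalescing \<delta>7 {n. odd n \<and> n \<noteq> 1} (\<lambda>_. UNIV)"
    unfolding coalescing_def \<delta>7
    by (rule exI[of _ 6000], rule exI[of _ 4], intro ballI odd_ring.expected_coalescence_time_le big)
      auto
qed
end
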